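(* Let $0\le s\le d$ and let $\mathbb S^d$ be the pseudo-Euclidean space of signature parameter $s$. A graph $\Gamma$ is generically globally rigid in $\mathbb E^d$ if and only if it is generically globally rigid in $\mathbb S^d$.
   Context: For a fixed integer $0\le s\le d$, $\mathbb S^d$ denotes $\mathbb R^d$ with squared length $|w|^2=-\sum_{i=1}^s w_i^2+\sum_{i=s+1}^d w_i^2$; $\mathbb E^d$ is the case $s=0$. A graph $\Gamma$ has vertex set $\mathcal V$ ($v$ vertices) and edge set $\mathcal E$. A framework of $\Gamma$ in $\mathbb F^d$ ($\mathbb F\in\{\mathbb E,\mathbb S\}$) is a map $\rho:\mathcal V\to\mathbb R^d$. Frameworks $\rho,\sigma$ are equivalent if $|\rho(t)-\rho(u)|^2=|\sigma(t)-\sigma(u)|^2$ (in the relevant metric) for all edges $\{t,u\}$, and congruent if this holds for all pairs of vertices. A framework is globally rigid in $\mathbb F^d$ if every equivalent framework of $\Gamma$ in $\mathbb F^d$ is congruent to it. A framework is generic if its real coordinates satisfy no nonzero polynomial equation with rational coefficients. $\Gamma$ is generically globally rigid (GGR) in $\mathbb F^d$ if all generic frameworks of $\Gamma$ in $\mathbb F^d$ are globally rigid. *)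

theory Defs
  imports Complex_Main
begin

text \<open>Points of R^d are represented as functions nat => real; only the
coordinates 0..d-1 are relevant. The pseudo-Euclidean squared length with
parameter s: the first s coordinates count negatively.\<close>

definition psq :: "nat \<Rightarrow> nat \<Rightarrow> (nat \<Rightarrow> real) \<Rightarrow> real" where
  "psq s d w = - (\<Sum>i<s. (w i)^2) + (\<Sum>i\<in>{s..<d}. (w i)^2)"

definition is_graph :: "'v set \<Rightarrow> 'v set set \<Rightarrow> bool" where
  "is_graph V E \<longleftrightarrow> finite V \<and> (\<forall>e\<in>E. \<exists>t u. t \<in> V \<and> u \<in> V \<and> t \<noteq> u \<and> e = {t, u})"

definition equivalent_fw ::
  "nat \<Rightarrow> nat \<Rightarrow> 'v set set \<Rightarrow> ('v \<Rightarrow> nat \<Rightarrow> real) \<Rightarrow> ('v \<Rightarrow> nat \<Rightarrow> real) \<Rightarrow> bool" where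
  "equivalent_fw s d E \<rho> \<sigma> \<longleftrightarrow>
     (\<forall>t u. {t, u} \<in> E \<longrightarrow> psq s d (\<rho> t - \<rho> u) = psq s d (\<sigma> t - \<sigma> u))"

definition congruent_fw ::
  "nat \<Rightarrow> nat \<Rightarrow> 'v set \<Rightarrow> ('v \<Rightarrow> nat \<Rightarrow> real) \<Rightarrow> ('v \<Rightarrow> nat \<Rightarrow> real) \<Rightarrow> bool" where
  "congruent_fw s d V \<rho> \<sigma> \<longleftrightarrow>
     (\<forall>t\<in>V. \<forall>u\<in>V. psq s d (\<rho> t - \<rho> u) = psq s d (\<sigma> t - \<sigma> u))"

definition globally_rigid ::
  "nat \<Rightarrow> nat \<Rightarrow> 'v set \<Rightarrow> 'v set set \<Rightarrow> ('v \<Rightarrow> nat \<Rightarrow> real) \<Rightarrow> bool" where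
  "globally_rigid s d V E \<rho> \<longleftrightarrow>
     (\<forall>\<sigma>. equivalent_fw s d E \<rho> \<sigma> \<longrightarrow> congruent_fw s d V \<rho> \<sigma>)"

text \<open>Algebraic independence over Q of a finite family x indexed by I:
no nonzero polynomial with rational coefficients (given by a finitely
supported coefficient function on monomials = exponent vectors supported in I)
vanishes at x.\<close>

definition alg_indep_Q :: "'i set \<Rightarrow> ('i \<Rightarrow> real) \<Rightarrow> bool" where
  "alg_indep_Q I x \<longleftrightarrow>
     (\<forall>c :: ('i \<Rightarrow> nat) \<Rightarrow> real.
        finite {m. c m \<noteq> 0} \<and> (\<forall>m. c m \<in> \<rat>) \<and>
        (\<forall>m. c m \<noteq> 0 \<longrightarrow> (\<forall>i. i \<notin> I \<longrightarrow> m i = 0)) \<and>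
        (\<Sum>m\<in>{m. c m \<noteq> 0}. c m * (\<Prod>i\<in>I. x i ^ m i)) = 0
        \<longrightarrow> (\<forall>m. c m = 0))"

definition generic_fw :: "nat \<Rightarrow> 'v set \<Rightarrow> ('v \<Rightarrow> nat \<Rightarrow> real) \<Rightarrow> bool" where
  "generic_fw d V \<rho> \<longleftrightarrow> alg_indep_Q (V \<times> {..<d}) (\<lambda>(v, i). \<rho> v i)"

definition GGR :: "nat \<Rightarrow> nat \<Rightarrow> 'v set \<Rightarrow> 'v set set \<Rightarrow> bool" where
  "GGR s d V E \<longleftrightarrow> (\<forall>\<rho>. generic_fw d V \<rho> \<longrightarrow> globally_rigid s d V E \<rho>)"

end

theory Submission
  imports Defs "HOL-Computational_Algebra.Polynomial" "HOL-Library.Countable_Set"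
    "HOL-Analysis.Continuum_Not_Denumerable"
begin

text \<open>Flip the signs of the form one at a time. A pair \<open>(\<rho>, \<sigma>)\<close> of equivalent frameworks satisfies
  \<open>\<Sum>\<^sub>i \<epsilon>\<^sub>i ((\<Delta>\<rho>\<^sub>i)\<^sup>2 - (\<Delta>\<sigma>\<^sub>i)\<^sup>2) = 0\<close> on the edges, so exchanging the \<open>k\<close>-th coordinates of \<open>\<rho>\<close> and
  \<open>\<sigma>\<close> yields a pair \<open>(P, S)\<close> that is equivalent for the form with \<open>\<epsilon>\<^sub>k\<close> flipped. A hyperbolic rotation
  of \<open>(\<rho>\<^sub>k, \<sigma>\<^sub>k)\<close> before the exchange leaves \<open>(\<Delta>\<rho>\<^sub>k)\<^sup>2 - (\<Delta>\<sigma>\<^sub>k)\<^sup>2\<close> unchanged and replaces \<open>P\<^sub>k\<close> by a multiple of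
  \<open>\<rho>\<^sub>k + \<tau> \<sigma>\<^sub>k\<close>. What is left is to make the new pair generic.

  Let \<open>I\<close> be a set of edges whose lengths at the generic \<open>\<rho>\<close> form a transcendence basis of all edge
  lengths. Derivations dual to this basis show that the rows \<open>I\<close> of the rigidity matrix of \<open>\<rho>\<close> are
  independent; since \<open>\<tau> = 0\<close> gives back \<open>\<rho>\<close>, they stay independent at \<open>P\<close> for all but finitely many
  \<open>\<tau>\<close>. Hence for generic \<open>S'\<close> close to \<open>S\<close> there is \<open>P'\<close> close to \<open>P\<close> with the same lengths as \<open>S'\<close> on
  \<open>I\<close>. Undoing the exchange turns \<open>(P', S')\<close> into a pair close to \<open>(\<rho>, \<sigma>)\<close> that agrees on \<open>I\<close>; every
  other edge length is a simple root of a polynomial whose coefficients depend on the lengths in \<open>I\<close>,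
  so it agrees as well.\<close>

section \<open>Derivations on subrings of the reals\<close>

definition is_subring :: "real set \<Rightarrow> bool" where
  "is_subring A \<longleftrightarrow> 1 \<in> A \<and> (\<forall>a\<in>A. - a \<in> A) \<and> (\<forall>a\<in>A. \<forall>b\<in>A. a + b \<in> A \<and> a * b \<in> A)"

text \<open>The values of \<open>D\<close> lie in the reals and need not lie in \<open>A\<close>.
  This allows a derivation to be extended to algebraic elements by dividing by a nonzero
  real.\<close>

definition derivation_on :: "real set \<Rightarrow> (real \<Rightarrow> real) \<Rightarrow> bool" where
  "derivation_on A D \<longleftrightarrow>
     (\<forall>a\<in>A. \<forall>b\<in>A. D (a + b) = D a + D b \<and> D (a * b) = a * D b + b * D a)"

definition polys_over :: "real set \<Rightarrow> real poly set" where
  "polys_over A = {p. \<forall>i. coeff p i \<in> A}"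

definition algebraic_over :: "real set \<Rightarrow> real \<Rightarrow> bool" where
  "algebraic_over A a \<longleftrightarrow> (\<exists>p\<in>polys_over A. p \<noteq> 0 \<and> poly p a = 0)"

definition adjoin :: "real set \<Rightarrow> real \<Rightarrow> real set" where
  "adjoin A a = (\<lambda>p. poly p a) ` polys_over A"

lemma subring_0: "is_subring A \<Longrightarrow> 0 \<in> A"
  unfolding is_subring_def by (metis add.right_inverse)

lemma subring_diff: "is_subring A \<Longrightarrow> a \<in> A \<Longrightarrow> b \<in> A \<Longrightarrow> a - b \<in> A"
  unfolding is_subring_def by (metis diff_conv_add_uminus)

lemma subring_of_nat: "is_subring A \<Longrightarrow> of_nat n \<in> A"
  by (induction n) (auto simp: subring_0 is_subring_def)

lemma subring_sum: "is_subring A \<Longrightarrow> (\<And>i. i \<in> I \<Longrightarrow> f i \<in> A) \<Longrightarrow> sum f I \<in> A"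
  by (induction I rule: infinite_finite_induct) (auto simp: subring_0 is_subring_def)

lemma polys_over_pCons: "pCons c p \<in> polys_over A \<longleftrightarrow> c \<in> A \<and> p \<in> polys_over A"
  by (auto simp: polys_over_def coeff_pCons split: nat.splits)

lemma polys_over_closed:
  assumes "is_subring A"
  shows "0 \<in> polys_over A" "1 \<in> polys_over A"
    "p \<in> polys_over A \<Longrightarrow> - p \<in> polys_over A"
    "p \<in> polys_over A \<Longrightarrow> q \<in> polys_over A \<Longrightarrow> p + q \<in> polys_over A"
    "p \<in> polys_over A \<Longrightarrow> q \<in> polys_over A \<Longrightarrow> p - q \<in> polys_over A"
    "p \<in> polys_over A \<Longrightarrow> q \<in> polys_over A \<Longrightarrow> p * q \<in> polys_over A"
    "c \<in> A \<Longrightarrow> p \<in> polys_over A \<Longrightarrow> smult c p \<in> polys_over A"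
    "c \<in> A \<Longrightarrow> monom c n \<in> polys_over A"
    "p \<in> polys_over A \<Longrightarrow> pderiv p \<in> polys_over A"
  using assms subring_0[OF assms] subring_diff[OF assms] subring_of_nat[OF assms]
  by (auto simp: polys_over_def coeff_mult coeff_pderiv is_subring_def
      simp del: of_nat_Suc intro!: subring_sum[OF assms])

lemma is_subring_adjoin:
  assumes "is_subring A" shows "is_subring (adjoin A a)"
  unfolding is_subring_def adjoin_def
  using polys_over_closed[OF assms]
  by (auto simp: image_iff simp flip: poly_add poly_mult poly_minus)
     (metis poly_1)+

lemma subset_adjoin: "is_subring A \<Longrightarrow> A \<subseteq> adjoin A a"
  by (rule subsetI, unfold adjoin_def, rule_tac x = "[:x:]" in image_eqI)
     (auto simp: polys_over_pCons polys_over_closed)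

lemma mem_adjoin: "is_subring A \<Longrightarrow> a \<in> adjoin A a"
  unfolding adjoin_def
  by (rule image_eqI[where x = "[:0, 1:]"])
     (auto simp: polys_over_pCons polys_over_closed subring_0 is_subring_def)

text \<open>The chain rule: a derivation that extends \<open>D\<close> and sends \<open>a\<close> to
  \<open>u\<close> must take this value at \<open>poly p a\<close>.\<close>

definition lift_deriv :: "(real \<Rightarrow> real) \<Rightarrow> real \<Rightarrow> real \<Rightarrow> real poly \<Rightarrow> real" where
  "lift_deriv D a u p = poly (map_poly D p) a + u * poly (pderiv p) a"

context
  fixes A :: "real set" and D :: "real \<Rightarrow> real" and a u :: real
  assumes A: "is_subring A" and D: "derivation_on A D"
begin

lemma derivation_0: "D 0 = 0"
  using D subring_0[OF A] unfolding derivation_on_def by (metis add_cancel_right_left)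

lemma derivation_1: "D 1 = 0"
proof -
  have "D (1 * 1) = 1 * D 1 + 1 * D 1"
    using D A unfolding derivation_on_def is_subring_def by blast
  then show ?thesis by simp
qed

lemma derivation_minus: "b \<in> A \<Longrightarrow> D (- b) = - D b"
  using D A derivation_0 unfolding derivation_on_def is_subring_def
  by (metis add.right_inverse add_eq_0_iff)

lemma derivation_diff: "b \<in> A \<Longrightarrow> c \<in> A \<Longrightarrow> D (b - c) = D b - D c"
  using D A derivation_minus[of c] unfolding derivation_on_def is_subring_def
  by (metis diff_conv_add_uminus)

lemma derivation_sum: "(\<And>i. i \<in> I \<Longrightarrow> f i \<in> A) \<Longrightarrow> D (sum f I) = (\<Sum>i\<in>I. D (f i))"
proof (induction I rule: infinite_finite_induct)
  case (insert x F)
  then show ?case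
    using D subring_sum[OF A, of F f] by (simp add: derivation_on_def)
qed (auto simp: derivation_0)

lemma lift_deriv_pCons:
  "lift_deriv D a u (pCons c p) = D c + a * lift_deriv D a u p + u * poly p a"
  by (simp add: lift_deriv_def map_poly_pCons derivation_0 pderiv_pCons algebra_simps)

lemma lift_deriv_0: "lift_deriv D a u 0 = 0"
  by (simp add: lift_deriv_def)

lemma lift_deriv_add:
  assumes "p \<in> polys_over A" "q \<in> polys_over A"
  shows "lift_deriv D a u (p + q) = lift_deriv D a u p + lift_deriv D a u q"
  using assms
proof (induction p q rule: poly_induct2)
  case (pCons c p b q)
  then show ?case
    using D by (auto simp: lift_deriv_pCons polys_over_pCons derivation_on_def algebra_simps)
qed (simp add: lift_deriv_0)

lemma lift_deriv_smult:
  assumes "c \<in> A" "q \<in> polys_over A"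
  shows "lift_deriv D a u (smult c q) = c * lift_deriv D a u q + D c * poly q a"
  using assms(2)
proof (induction q)
  case (pCons b q)
  then show ?case
    using D assms(1)
    by (auto simp: lift_deriv_pCons polys_over_pCons derivation_on_def algebra_simps)
qed (simp add: lift_deriv_0)

lemma lift_deriv_mult:
  assumes "p \<in> polys_over A" "q \<in> polys_over A"
  shows "lift_deriv D a u (p * q) = poly p a * lift_deriv D a u q + poly q a * lift_deriv D a u p"
  using assms(1)
proof (induction p)
  case (pCons c p)
  then have "c \<in> A" "p \<in> polys_over A" by (auto simp: polys_over_pCons)
  moreover have "pCons 0 (p * q) \<in> polys_over A"
    using \<open>p \<in> polys_over A\<close> assms(2) polys_over_closed[OF A] subring_0[OF A]
    by (simp add: polys_over_pCons)
  ultimately show ?case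
    using pCons.IH assms(2) polys_over_closed[OF A]
    by (simp add: lift_deriv_add lift_deriv_smult)
       (simp add: lift_deriv_pCons derivation_0 algebra_simps)
qed (simp add: lift_deriv_0)

text \<open>An element of the ring generated by \<open>A\<close> and \<open>a\<close> may have
  several representations \<open>poly p a\<close>. Two of them differ by a polynomial vanishing at
  \<open>a\<close>, so \<open>wd\<close> makes the chain-rule value well defined; sum and product
  rules are then inherited from \<open>lift_deriv\<close>.\<close>

lemma derivation_adjoin_if_compatible:
  assumes wd: "\<And>p. p \<in> polys_over A \<Longrightarrow> poly p a = 0 \<Longrightarrow> lift_deriv D a u p = 0"
  shows "\<exists>D'. derivation_on (adjoin A a) D' \<and> (\<forall>b\<in>A. D' b = D b) \<and> D' a = u"
proof -
  note cl = polys_over_closed[OF A]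
  define D' where "D' b = lift_deriv D a u (SOME p. p \<in> polys_over A \<and> poly p a = b)" for b
  have D': "D' (poly p a) = lift_deriv D a u p" if p: "p \<in> polys_over A" for p
  proof -
    define q where "q = (SOME q. q \<in> polys_over A \<and> poly q a = poly p a)"
    have q: "q \<in> polys_over A" "poly q a = poly p a"
      using someI[of "\<lambda>q. q \<in> polys_over A \<and> poly q a = poly p a" p] p by (auto simp: q_def)
    have "lift_deriv D a u (q - p) = 0" using q p cl by (intro wd) auto
    moreover have "lift_deriv D a u q = lift_deriv D a u (q - p) + lift_deriv D a u p"
      using lift_deriv_add[of "q - p" p] q p cl by simp
    ultimately show ?thesis by (simp add: D'_def q_def)
  qed
  have "derivation_on (adjoin A a) D'"
    unfolding derivation_on_def adjoin_def
    using cl by (auto simp: D' lift_deriv_add lift_deriv_mult simp flip: poly_add poly_mult)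
  moreover have "D' b = D b" if "b \<in> A" for b
    using D'[of "[:b:]"] that cl by (simp add: polys_over_pCons lift_deriv_pCons lift_deriv_0)
  moreover have "D' a = u"
    using D'[of "[:0, 1:]"] cl subring_0[OF A] A
    by (simp add: polys_over_pCons lift_deriv_pCons lift_deriv_0 derivation_0 derivation_1
        is_subring_def)
  ultimately show ?thesis by blast
qed

end

text \<open>Take an annihilating polynomial of least degree. Its derivative also has coefficients in
  \<open>A\<close>, is nonzero in characteristic 0 and has smaller degree, so it cannot vanish at
  \<open>a\<close>.\<close>

lemma algebraic_over_minimal:
  assumes A: "is_subring A" and "algebraic_over A a"
  obtains m where "m \<in> polys_over A" "m \<noteq> 0" "poly m a = 0" "poly (pderiv m) a \<noteq> 0"
    "\<And>p. p \<in> polys_over A \<Longrightarrow> p \<noteq> 0 \<Longrightarrow> poly p a = 0 \<Longrightarrow> degree m \<le> degree p"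
proof -
  let ?P = "\<lambda>p. p \<in> polys_over A \<and> p \<noteq> 0 \<and> poly p a = 0"
  obtain m where m: "?P m" and min: "\<And>p. ?P p \<Longrightarrow> degree m \<le> degree p"
    using assms(2) ex_has_least_nat[of ?P _ degree] unfolding algebraic_over_def by blast
  have deg: "degree m \<noteq> 0"
    using m by (metis degree_0_id degree_eq_zeroE pCons_0_0 poly_pCons mult_zero_right add_0_right poly_0)
  have "poly (pderiv m) a \<noteq> 0"
  proof
    assume "poly (pderiv m) a = 0"
    moreover have "pderiv m \<noteq> 0" using deg by (simp add: pderiv_eq_0_iff)
    ultimately have "degree m \<le> degree (pderiv m)"
      using m polys_over_closed[OF A] by (intro min) auto
    then show False using deg by (simp add: degree_pderiv)
  qed
  then show thesis using that m min by blast
qed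

text \<open>Only the zero polynomial vanishes at \<open>a\<close>, so compatibility is trivial and
  \<open>u\<close> can be prescribed freely.\<close>

lemma derivation_adjoin_transcendental:
  assumes "is_subring A" "derivation_on A D" "\<not> algebraic_over A a"
  shows "\<exists>D'. derivation_on (adjoin A a) D' \<and> (\<forall>b\<in>A. D' b = D b) \<and> D' a = u"
proof (rule derivation_adjoin_if_compatible[OF assms(1,2)])
  fix p assume "p \<in> polys_over A" "poly p a = 0"
  then have "p = 0" using assms(3) by (auto simp: algebraic_over_def)
  then show "lift_deriv D a u p = 0" by (simp add: lift_deriv_0[OF assms(1,2)])
qed

lemma derivation_adjoin:
  assumes A: "is_subring A" and D: "derivation_on A D"
  shows "\<exists>D'. derivation_on (adjoin A a) D' \<and> (\<forall>b\<in>A. D' b = D b)"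
proof (cases "algebraic_over A a")
  case False
  then show ?thesis using derivation_adjoin_transcendental[OF A D] by blast
next
  case True
  note cl = polys_over_closed[OF A]
  obtain m where m: "m \<in> polys_over A" "m \<noteq> 0" "poly m a = 0" "poly (pderiv m) a \<noteq> 0"
    and min: "\<And>p. p \<in> polys_over A \<Longrightarrow> p \<noteq> 0 \<Longrightarrow> poly p a = 0 \<Longrightarrow> degree m \<le> degree p"
    using algebraic_over_minimal[OF A True] by metis
  \<comment> \<open>The value forced by \<open>m\<close>: differentiating
    \<open>poly m a = 0\<close> gives a linear equation for \<open>u\<close>, solvable since
    \<open>a\<close> is a simple root.\<close>
  define u where "u = - poly (map_poly D m) a / poly (pderiv m) a"
  have Lm: "lift_deriv D a u m = 0" using m(4) by (simp add: lift_deriv_def u_def)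
  have "lift_deriv D a u p = 0" if "p \<in> polys_over A" "poly p a = 0" for p
    using that
  proof (induction "degree p" arbitrary: p rule: less_induct)
    case less
    show ?case
    proof (cases "p = 0")
      case True then show ?thesis by (simp add: lift_deriv_0[OF A D])
    next
      case False
      then have dm: "degree m \<le> degree p" using min less.prems by blast
      \<comment> \<open>Pseudo-division: \<open>A\<close> is only a ring, so \<open>p\<close> is
        first multiplied by the leading coefficient \<open>c\<close> of \<open>m\<close>.
        Subtracting \<open>b * m\<close> then cancels the leading term and the induction applies to
        \<open>q\<close>.\<close>
      define c where "c = lead_coeff m"
      define b where "b = monom (lead_coeff p) (degree p - degree m)"
      define q where "q = smult c p - b * m"
      have c: "c \<in> A" "c \<noteq> 0" using m by (auto simp: c_def polys_over_def)
      have b: "b \<in> polys_over A" using less.prems cl by (auto simp: b_def polys_over_def)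
      have q: "q \<in> polys_over A" "poly q a = 0"
        using c b m less.prems cl by (auto simp: q_def)
      have degbm: "degree (b * m) = degree p"
        using False m(2) dm by (simp add: b_def degree_mult_eq degree_monom_eq)
      have "lead_coeff (b * m) = lead_coeff (smult c p)"
        using False by (simp add: lead_coeff_mult b_def c_def degree_monom_eq)
      then have cq: "coeff q (degree p) = 0"
        using degbm c by (simp add: q_def)
      have "degree q \<le> degree p"
        unfolding q_def by (rule degree_diff_le) (use degbm in auto)
      then have "q = 0 \<or> degree q < degree p"
        using cq by (metis leading_coeff_0_iff le_neq_implies_less)
      then have "lift_deriv D a u q = 0"
        using less.hyps[of q] q lift_deriv_0[OF A D] by auto
      moreover have "smult c p = q + b * m" by (simp add: q_def)
      ultimately have "lift_deriv D a u (smult c p) = 0"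
        using q b m cl Lm by (simp add: lift_deriv_add[OF A D] lift_deriv_mult[OF A D])
      then have "c * lift_deriv D a u p = 0"
        using c less.prems by (simp add: lift_deriv_smult[OF A D])
      then show ?thesis using c by simp
    qed
  qed
  from derivation_adjoin_if_compatible[OF A D this] show ?thesis by blast
qed

lemma derivation_extend_finite:
  assumes "finite S" "is_subring A" "derivation_on A D"
  shows "\<exists>A' D'. is_subring A' \<and> A \<union> S \<subseteq> A' \<and> derivation_on A' D' \<and> (\<forall>b\<in>A. D' b = D b)"
  using assms(1)
proof (induction S rule: finite_induct)
  case empty
  then show ?case using assms by auto
next
  case (insert a S)
  then obtain A' D' where *: "is_subring A'" "A \<union> S \<subseteq> A'" "derivation_on A' D'" "\<forall>b\<in>A. D' b = D b"
    by blast
  obtain D'' where D'': "derivation_on (adjoin A' a) D''" "\<forall>b\<in>A'. D'' b = D' b"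
    using derivation_adjoin[OF *(1,3)] by blast
  show ?case
    using is_subring_adjoin[OF *(1), of a] D'' * mem_adjoin[OF *(1), of a] subset_adjoin[OF *(1), of a]
    by (intro exI[of _ "adjoin A' a"] exI[of _ D'']) auto
qed

section \<open>Polynomials with rational coefficients and genericity\<close>

text \<open>Rational polynomials as a closure of functions: composition, limits and dependence on
  \<open>I\<close> follow by rule induction. \<open>rat_polys_expand\<close> leads back to the
  coefficient form in \<open>alg_indep_Q\<close>.\<close>

inductive_set rat_polys :: "'i set \<Rightarrow> (('i \<Rightarrow> real) \<Rightarrow> real) set" for I :: "'i set" where
  rat_polys_const: "r \<in> \<rat> \<Longrightarrow> (\<lambda>x. r) \<in> rat_polys I"
| rat_polys_var: "i \<in> I \<Longrightarrow> (\<lambda>x. x i) \<in> rat_polys I"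
| rat_polys_add: "g \<in> rat_polys I \<Longrightarrow> h \<in> rat_polys I \<Longrightarrow> (\<lambda>x. g x + h x) \<in> rat_polys I"
| rat_polys_mult: "g \<in> rat_polys I \<Longrightarrow> h \<in> rat_polys I \<Longrightarrow> (\<lambda>x. g x * h x) \<in> rat_polys I"

lemma rat_polys_minus: "g \<in> rat_polys I \<Longrightarrow> (\<lambda>x. - g x) \<in> rat_polys I"
  using rat_polys_mult[OF rat_polys_const[of "-1"], of g I] by simp

lemma rat_polys_diff:
  "g \<in> rat_polys I \<Longrightarrow> h \<in> rat_polys I \<Longrightarrow> (\<lambda>x. g x - h x) \<in> rat_polys I"
  using rat_polys_add[OF _ rat_polys_minus, of g I h] by simp

lemma rat_polys_power: "g \<in> rat_polys I \<Longrightarrow> (\<lambda>x. g x ^ n) \<in> rat_polys I"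
  by (induction n) (auto intro: rat_polys_const rat_polys_mult)

lemma rat_polys_sum:
  "(\<And>j. j \<in> J \<Longrightarrow> g j \<in> rat_polys I) \<Longrightarrow> (\<lambda>x. \<Sum>j\<in>J. g j x) \<in> rat_polys I"
  by (induction J rule: infinite_finite_induct) (auto intro: rat_polys_const rat_polys_add)

lemma rat_polys_compose:
  assumes "g \<in> rat_polys J" "\<And>j. j \<in> J \<Longrightarrow> (\<lambda>x. f x j) \<in> rat_polys I"
  shows "(\<lambda>x. g (f x)) \<in> rat_polys I"
  using assms(1) by induction (auto intro: rat_polys.intros assms(2))

lemma rat_polys_cong:
  assumes "g \<in> rat_polys I" "\<And>i. i \<in> I \<Longrightarrow> x i = y i"
  shows "g x = g y"
  using assms(1) by induction (auto simp: assms(2))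

lemma rat_polys_mono: "g \<in> rat_polys I \<Longrightarrow> I \<subseteq> J \<Longrightarrow> g \<in> rat_polys J"
  by (induction rule: rat_polys.induct) (auto intro: rat_polys.intros)

lemma tendsto_rat_polys:
  assumes "g \<in> rat_polys I" "\<And>i. i \<in> I \<Longrightarrow> ((\<lambda>n. x n i) \<longlongrightarrow> y i) F"
  shows "((\<lambda>n. g (x n)) \<longlongrightarrow> g y) F"
  using assms(1) by induction (auto intro: tendsto_intros assms(2))

lemma rat_polys_expand:
  assumes "g \<in> rat_polys I" "finite I"
  shows "\<exists>c M. finite M \<and> (\<forall>m. c m \<in> \<rat>) \<and> (\<forall>m\<in>M. \<forall>i. i \<notin> I \<longrightarrow> m i = 0) \<and>
    (\<forall>x. g x = (\<Sum>m\<in>M. c m * (\<Prod>i\<in>I. x i ^ m i)))"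
  using assms(1)
proof induction
  case (rat_polys_const r)
  then show ?case
    by (intro exI[of _ "\<lambda>_. r"] exI[of _ "{\<lambda>_. 0}"]) auto
next
  case (rat_polys_var i)
  have "(\<Prod>j\<in>I. x j ^ (if j = i then 1 else 0)) = x i" for x :: "_ \<Rightarrow> real"
    using rat_polys_var assms(2) by (simp add: if_distrib prod.delta cong: if_cong)
  then show ?case
    using rat_polys_var
    by (intro exI[of _ "\<lambda>_. 1"] exI[of _ "{\<lambda>j. if j = i then 1 else 0}"]) auto
next
  case (rat_polys_add g h)
  then obtain c M c' M' where
    c: "finite M" "\<forall>m. c m \<in> \<rat>" "\<forall>m\<in>M. \<forall>i. i \<notin> I \<longrightarrow> m i = 0"
      "\<forall>x. g x = (\<Sum>m\<in>M. c m * (\<Prod>i\<in>I. x i ^ m i))" and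
    c': "finite M'" "\<forall>m. c' m \<in> \<rat>" "\<forall>m\<in>M'. \<forall>i. i \<notin> I \<longrightarrow> m i = 0"
      "\<forall>x. h x = (\<Sum>m\<in>M'. c' m * (\<Prod>i\<in>I. x i ^ m i))"
    by blast
  \<comment> \<open>\<open>c\<close> and \<open>c'\<close> are unconstrained outside
    \<open>M\<close> and \<open>M'\<close>, so they are cut off before both sums are extended to the
    union.\<close>
  define b where "b m = (if m \<in> M then c m else 0) + (if m \<in> M' then c' m else 0)" for m
  have "g x = (\<Sum>m\<in>M \<union> M'. (if m \<in> M then c m else 0) * (\<Prod>i\<in>I. x i ^ m i))" for x
    unfolding c(4)[rule_format] by (rule sum.mono_neutral_cong_left) (use c c' in auto)
  moreover have "h x = (\<Sum>m\<in>M \<union> M'. (if m \<in> M' then c' m else 0) * (\<Prod>i\<in>I. x i ^ m i))" for x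
    unfolding c'(4)[rule_format] by (rule sum.mono_neutral_cong_left) (use c c' in auto)
  ultimately have "g x + h x = (\<Sum>m\<in>M \<union> M'. b m * (\<Prod>i\<in>I. x i ^ m i))" for x
    by (simp add: b_def sum.distrib[symmetric] distrib_right)
  moreover have "b m \<in> \<rat>" for m using c(2) c'(2) by (simp add: b_def)
  ultimately show ?case
    using c(1,3) c'(1,3) by (intro exI[of _ b] exI[of _ "M \<union> M'"]) auto
next
  case (rat_polys_mult g h)
  then obtain c M c' M' where
    c: "finite M" "\<forall>m. c m \<in> \<rat>" "\<forall>m\<in>M. \<forall>i. i \<notin> I \<longrightarrow> m i = 0"
      "\<forall>x. g x = (\<Sum>m\<in>M. c m * (\<Prod>i\<in>I. x i ^ m i))" and
    c': "finite M'" "\<forall>m. c' m \<in> \<rat>" "\<forall>m\<in>M'. \<forall>i. i \<notin> I \<longrightarrow> m i = 0"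
      "\<forall>x. h x = (\<Sum>m\<in>M'. c' m * (\<Prod>i\<in>I. x i ^ m i))"
    by blast
  \<comment> \<open>Multiplying monomials adds exponent vectors. Different pairs may give the same
    vector, hence the coefficients are summed over the fibres of \<open>pl\<close>.\<close>
  define pl :: "('a \<Rightarrow> nat) \<times> ('a \<Rightarrow> nat) \<Rightarrow> 'a \<Rightarrow> nat" where
    "pl = (\<lambda>(m, m') i. m i + m' i)"
  define b where
    "b n = (\<Sum>z\<in>{z. z \<in> M \<times> M' \<and> pl z = n}. c (fst z) * c' (snd z))" for n
  have "g x * h x = (\<Sum>n\<in>pl ` (M \<times> M'). b n * (\<Prod>i\<in>I. x i ^ n i))" for x
  proof -
    have "g x * h x = (\<Sum>z\<in>M \<times> M'. c (fst z) * c' (snd z) * (\<Prod>i\<in>I. x i ^ pl z i))"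
      unfolding c(4)[rule_format] c'(4)[rule_format] sum_product sum.cartesian_product
      by (intro sum.cong) (auto simp: pl_def power_add prod.distrib)
    also have "\<dots> = (\<Sum>n\<in>pl ` (M \<times> M'). \<Sum>z\<in>{z. z \<in> M \<times> M' \<and> pl z = n}.
        c (fst z) * c' (snd z) * (\<Prod>i\<in>I. x i ^ pl z i))"
      by (rule sum.group[symmetric]) (use c(1) c'(1) in auto)
    also have "\<dots> = (\<Sum>n\<in>pl ` (M \<times> M'). b n * (\<Prod>i\<in>I. x i ^ n i))"
      unfolding b_def sum_distrib_right by (intro sum.cong) auto
    finally show ?thesis .
  qed
  moreover have "b n \<in> \<rat>" for n unfolding b_def using c(2) c'(2) by (intro Rats_sum) auto
  moreover have "\<forall>n\<in>pl ` (M \<times> M'). \<forall>i. i \<notin> I \<longrightarrow> n i = 0"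
    using c(3) c'(3) by (auto simp: pl_def)
  ultimately show ?case
    using c(1) c'(1) by (intro exI[of _ b] exI[of _ "pl ` (M \<times> M')"]) auto
qed

text \<open>A rational relation at one generic point has only zero coefficients after collecting
  monomials. It is therefore an identity and can be transferred to any other framework.\<close>

lemma rat_polys_eq_0_if_generic_root:
  assumes "finite I" "alg_indep_Q I x" "g \<in> rat_polys I" "g x = 0"
  shows "g y = 0"
proof -
  obtain c M where c: "finite M" "\<forall>m. c m \<in> \<rat>" "\<forall>m\<in>M. \<forall>i. i \<notin> I \<longrightarrow> m i = 0"
      "\<forall>x. g x = (\<Sum>m\<in>M. c m * (\<Prod>i\<in>I. x i ^ m i))"
    using rat_polys_expand[OF assms(3,1)] by blast
  define b where "b m = (if m \<in> M then c m else 0)" for m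
  have gb: "g z = (\<Sum>m\<in>{m. b m \<noteq> 0}. b m * (\<Prod>i\<in>I. z i ^ m i))" for z
    unfolding c(4)[rule_format]
    by (rule sum.mono_neutral_cong_right) (use c(1) in \<open>auto simp: b_def\<close>)
  have "finite {m. b m \<noteq> 0}" by (rule finite_subset[OF _ c(1)]) (auto simp: b_def)
  moreover have "\<forall>m. b m \<in> \<rat>" using c(2) by (auto simp: b_def)
  moreover have "\<forall>m. b m \<noteq> 0 \<longrightarrow> (\<forall>i. i \<notin> I \<longrightarrow> m i = 0)" using c(3) by (auto simp: b_def)
  moreover have "(\<Sum>m\<in>{m. b m \<noteq> 0}. b m * (\<Prod>i\<in>I. x i ^ m i)) = 0" using gb assms(4) by simp
  ultimately have "\<forall>m. b m = 0"
    using assms(2) unfolding alg_indep_Q_def by blast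
  then show ?thesis using gb[of y] by simp
qed

section \<open>Density of generic points\<close>

text \<open>The line passes through \<open>a\<close> at \<open>t = 0\<close> and through the generic
  \<open>x\<close> at \<open>t = 1\<close>. A nonzero rational polynomial does not vanish at
  \<open>t = 1\<close>, so it has finitely many zeros on the line, and there are countably many such
  polynomials.\<close>

lemma countable_nongeneric_on_line:
  fixes x a :: "'i \<Rightarrow> real"
  assumes I: "finite I" and x: "alg_indep_Q I x"
  shows "countable {t. \<not> alg_indep_Q I (\<lambda>i. a i + t * (x i - a i))}"
proof -
  let ?Mon = "{m :: 'i \<Rightarrow> nat. \<forall>i. i \<notin> I \<longrightarrow> m i = 0}"
  define C where "C = {c :: ('i \<Rightarrow> nat) \<Rightarrow> real. finite {m. c m \<noteq> 0} \<and> (\<forall>m. c m \<in> \<rat>) \<and>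
        (\<forall>m. c m \<noteq> 0 \<longrightarrow> (\<forall>i. i \<notin> I \<longrightarrow> m i = 0))}"
  define pe where "pe c z = (\<Sum>m\<in>{m. c m \<noteq> 0}. c m * (\<Prod>i\<in>I. z i ^ m i))"
    for c :: "('i \<Rightarrow> nat) \<Rightarrow> real" and z
  obtain xs where xs: "set xs = I" using I finite_list by blast
  have "countable ?Mon"
  proof (rule countableI')
    show "inj_on (\<lambda>m. to_nat (map m xs)) ?Mon"
    proof (rule inj_onI, rule ext)
      fix m m' :: "'i \<Rightarrow> nat" and i
      assume "m \<in> ?Mon" "m' \<in> ?Mon" "to_nat (map m xs) = to_nat (map m' xs)"
      then show "m i = m' i" using xs by (cases "i \<in> I") auto
    qed
  qed
  then have "countable (?Mon \<times> (\<rat> :: real set))" using countable_rat by blast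
  then have cnt: "countable {G. finite G \<and> G \<subseteq> ?Mon \<times> (\<rat> :: real set)}"
    by (rule countable_Collect_finite_subset)
  \<comment> \<open>Coding \<open>c\<close> by its graph over the support makes it a finite subset
    of a countable set.\<close>
  have inj: "inj_on (\<lambda>c. (\<lambda>m. (m, c m)) ` {m. c m \<noteq> 0}) C"
  proof (rule inj_onI, rule ext)
    fix c c' :: "('i \<Rightarrow> nat) \<Rightarrow> real" and m
    assume "(\<lambda>m. (m, c m)) ` {m. c m \<noteq> 0} = (\<lambda>m. (m, c' m)) ` {m. c' m \<noteq> 0}"
    then have "(m, r) \<in> (\<lambda>m. (m, c m)) ` {m. c m \<noteq> 0} \<longleftrightarrow> (m, r) \<in> (\<lambda>m. (m, c' m)) ` {m. c' m \<noteq> 0}" for r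
      by simp
    then have "(r = c m \<and> c m \<noteq> 0) \<longleftrightarrow> (r = c' m \<and> c' m \<noteq> 0)" for r by (auto simp: image_iff)
    then show "c m = c' m" by metis
  qed
  have "(\<lambda>c. (\<lambda>m. (m, c m)) ` {m. c m \<noteq> 0}) ` C \<subseteq> {G. finite G \<and> G \<subseteq> ?Mon \<times> (\<rat> :: real set)}"
    by (auto simp: C_def)
  from countable_image_inj_on[OF countable_subset[OF this cnt] inj] have C: "countable C" .
  have fin: "finite {t. pe c (\<lambda>i. a i + t * (x i - a i)) = 0}" if c: "c \<in> C" "\<exists>m. c m \<noteq> 0" for c
  proof -
    define p where "p = (\<Sum>m\<in>{m. c m \<noteq> 0}. [:c m:] * (\<Prod>i\<in>I. [:a i, x i - a i:] ^ m i))"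
    have p: "poly p t = pe c (\<lambda>i. a i + t * (x i - a i))" for t
      by (simp add: p_def pe_def poly_sum poly_prod)
    have "pe c x \<noteq> 0" using c x unfolding C_def pe_def alg_indep_Q_def by blast
    then have "poly p 1 \<noteq> 0" by (simp add: p)
    then have "p \<noteq> 0" by auto
    then show ?thesis using poly_roots_finite[of p] by (simp add: p)
  qed
  have "{t. \<not> alg_indep_Q I (\<lambda>i. a i + t * (x i - a i))}
      = (\<Union>c\<in>{c\<in>C. \<exists>m. c m \<noteq> 0}. {t. pe c (\<lambda>i. a i + t * (x i - a i)) = 0})"
    unfolding alg_indep_Q_def C_def pe_def by blast
  moreover have "countable \<dots>"
    by (rule countable_UN) (use fin C in \<open>auto intro: countable_finite countable_subset[OF _ C]\<close>)
  ultimately show ?thesis by simp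
qed

text \<open>Every interval of parameters near 0 is uncountable, so it contains one that avoids the
  countable exceptional set on the line from \<open>a\<close> to \<open>x\<close>.\<close>

lemma generic_approximation:
  fixes x a :: "'i \<Rightarrow> real"
  assumes "finite I" "alg_indep_Q I x"
  shows "\<exists>X :: nat \<Rightarrow> 'i \<Rightarrow> real. (\<forall>n. alg_indep_Q I (X n)) \<and> (\<forall>i. (\<lambda>n. X n i) \<longlonglongrightarrow> a i)"
proof -
  have "\<exists>t. t \<in> {0<..<1 / real (Suc n)} \<and> alg_indep_Q I (\<lambda>i. a i + t * (x i - a i))" for n
  proof (rule ccontr)
    assume "\<not> ?thesis"
    then have "{0<..<1 / real (Suc n)} \<subseteq> {t. \<not> alg_indep_Q I (\<lambda>i. a i + t * (x i - a i))}"
      by blast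
    then have "countable {0<..<1 / real (Suc n)}"
      using countable_nongeneric_on_line[OF assms] countable_subset by blast
    then show False using uncountable_open_interval[of 0 "1 / real (Suc n)"] by simp
  qed
  then obtain t where t: "\<And>n. t n \<in> {0<..<1 / real (Suc n)}"
    "\<And>n. alg_indep_Q I (\<lambda>i. a i + t n * (x i - a i))"
    by metis
  have "t \<longlonglongrightarrow> 0"
  proof (rule tendsto_sandwich)
    show "\<forall>\<^sub>F n in sequentially. 0 \<le> t n" "\<forall>\<^sub>F n in sequentially. t n \<le> 1 / real (Suc n)"
      using t(1) by (auto simp: less_imp_le)
    show "(\<lambda>n. 1 / real (Suc n)) \<longlonglongrightarrow> 0"
      using LIMSEQ_inverse_real_of_nat by (simp add: inverse_eq_divide)
  qed auto
  then have "(\<lambda>n. a i + t n * (x i - a i)) \<longlonglongrightarrow> a i + 0 * (x i - a i)" for i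
    by (intro tendsto_intros)
  then show ?thesis using t(2) by (intro exI[of _ "\<lambda>n i. a i + t n * (x i - a i)"]) auto
qed

section \<open>Transcendence bases and dual derivations\<close>

definition rat_ring :: "'i set \<Rightarrow> ('i \<Rightarrow> real) \<Rightarrow> real set" where
  "rat_ring I y = {g y |g. g \<in> rat_polys I}"

lemma rat_ringI: "g \<in> rat_polys I \<Longrightarrow> a = g y \<Longrightarrow> a \<in> rat_ring I y"
  by (auto simp: rat_ring_def)

lemma rat_ring_generator: "i \<in> I \<Longrightarrow> y i \<in> rat_ring I y"
  by (rule rat_ringI[OF rat_polys_var]) simp_all

lemma is_subring_rat_ring: "is_subring (rat_ring I y)"
  unfolding is_subring_def
proof (intro conjI ballI)
  show "1 \<in> rat_ring I y" by (rule rat_ringI[OF rat_polys_const[of 1]]) simp_all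
next
  fix a assume "a \<in> rat_ring I y"
  then obtain g where g: "g \<in> rat_polys I" "a = g y" by (auto simp: rat_ring_def)
  show "- a \<in> rat_ring I y" by (rule rat_ringI[OF rat_polys_minus[OF g(1)]]) (simp add: g)
next
  fix a b assume "a \<in> rat_ring I y" "b \<in> rat_ring I y"
  then obtain g h where gh: "g \<in> rat_polys I" "h \<in> rat_polys I" "a = g y" "b = h y"
    by (auto simp: rat_ring_def)
  show "a + b \<in> rat_ring I y" by (rule rat_ringI[OF rat_polys_add[OF gh(1,2)]]) (simp add: gh)
  show "a * b \<in> rat_ring I y" by (rule rat_ringI[OF rat_polys_mult[OF gh(1,2)]]) (simp add: gh)
qed

lemma rat_ring_insert_subset_adjoin: "rat_ring (insert e I) y \<subseteq> adjoin (rat_ring I y) (y e)"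
proof
  fix a assume "a \<in> rat_ring (insert e I) y"
  then obtain g where a: "a = g y" and g: "g \<in> rat_polys (insert e I)" by (auto simp: rat_ring_def)
  note R = is_subring_rat_ring[of I y]
  note sub = subset_adjoin[OF R, of "y e"]
  have ad: "is_subring (adjoin (rat_ring I y) (y e))" by (rule is_subring_adjoin[OF R])
  from g show "a \<in> adjoin (rat_ring I y) (y e)" unfolding a
  proof induction
    case (rat_polys_const r)
    then have "r \<in> rat_ring I y" by (rule rat_ringI[OF rat_polys.rat_polys_const]) simp
    then show ?case using sub by blast
  next
    case (rat_polys_var i)
    then show ?case using mem_adjoin[OF R, of "y e"] sub rat_ring_generator[of i I y] by blast
  qed (use ad in \<open>auto simp: is_subring_def\<close>)
qed

lemma rat_ring_mono: "I \<subseteq> J \<Longrightarrow> rat_ring I y \<subseteq> rat_ring J y"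
  by (auto simp: rat_ring_def intro: rat_polys_mono)

lemma derivation_on_subset: "derivation_on B D \<Longrightarrow> A \<subseteq> B \<Longrightarrow> derivation_on A D"
  unfolding derivation_on_def by blast

lemma algebraic_over_mono: "A \<subseteq> B \<Longrightarrow> algebraic_over A a \<Longrightarrow> algebraic_over B a"
  by (auto simp: algebraic_over_def polys_over_def)

text \<open>Greedy selection: \<open>k\<close> is added exactly when \<open>y k\<close> is
  transcendental over the ring generated so far. The old dual derivations are then extended by the
  value 0 at \<open>y k\<close>, and the zero derivation extended by the value 1 is dual to
  \<open>k\<close>.\<close>

lemma transcendence_basis_derivations:
  fixes y :: "'e \<Rightarrow> real"
  assumes "finite K"
  shows "\<exists>I\<subseteq>K. (\<forall>e\<in>K. algebraic_over (rat_ring I y) (y e)) \<and>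
    (\<forall>e\<in>I. \<exists>D. derivation_on (rat_ring I y) D \<and> (\<forall>e'\<in>I. D (y e') = (if e' = e then 1 else 0)))"
  using assms
proof (induction K rule: finite_induct)
  case empty
  then show ?case by auto
next
  case (insert k K)
  then obtain I where I: "I \<subseteq> K" "\<forall>e\<in>K. algebraic_over (rat_ring I y) (y e)"
    "\<forall>e\<in>I. \<exists>D. derivation_on (rat_ring I y) D \<and> (\<forall>e'\<in>I. D (y e') = (if e' = e then 1 else 0))"
    by blast
  note R = is_subring_rat_ring[of I y]
  show ?case
  proof (cases "algebraic_over (rat_ring I y) (y k)")
    case True
    then show ?thesis using I by (intro exI[of _ I]) auto
  next
    case False
    have ext: "\<exists>D'. derivation_on (rat_ring (insert k I) y) D' \<and> (\<forall>b\<in>rat_ring I y. D' b = D b) \<and> D' (y k) = u"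
      if D: "derivation_on (rat_ring I y) D" for D u
    proof -
      obtain D' where D': "derivation_on (adjoin (rat_ring I y) (y k)) D'"
        "\<forall>b\<in>rat_ring I y. D' b = D b" "D' (y k) = u"
        using derivation_adjoin_transcendental[OF R D False, of u] by blast
      from derivation_on_subset[OF D'(1) rat_ring_insert_subset_adjoin] D'(2,3) show ?thesis by blast
    qed
    note yI = rat_ring_generator[of _ I y]
    have kI: "k \<notin> I" using insert.hyps I(1) by blast
    have "\<exists>D. derivation_on (rat_ring (insert k I) y) D \<and>
        (\<forall>e'\<in>insert k I. D (y e') = (if e' = e then 1 else 0))" if e: "e \<in> insert k I" for e
    proof (cases "e = k")
      case True
      have "derivation_on (rat_ring I y) (\<lambda>_. 0)" by (simp add: derivation_on_def)
      from ext[OF this, of 1] obtain D where D: "derivation_on (rat_ring (insert k I) y) D"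
        "\<forall>b\<in>rat_ring I y. D b = 0" "D (y k) = 1" by blast
      then have "D (y e') = (if e' = e then 1 else 0)" if "e' \<in> insert k I" for e'
        using that True kI yI[of e'] by auto
      with D(1) show ?thesis by blast
    next
      case False
      then obtain D where D: "derivation_on (rat_ring I y) D" "\<forall>e'\<in>I. D (y e') = (if e' = e then 1 else 0)"
        using I(3) e by blast
      from ext[OF D(1), of 0] obtain D' where D': "derivation_on (rat_ring (insert k I) y) D'"
        "\<forall>b\<in>rat_ring I y. D' b = D b" "D' (y k) = 0" by blast
      then have "D' (y e') = (if e' = e then 1 else 0)" if "e' \<in> insert k I" for e'
        using that False kI yI[of e'] D(2) by auto
      with D'(1) show ?thesis by blast
    qed
    moreover have "algebraic_over (rat_ring (insert k I) y) (y e)" if "e \<in> insert k K" for e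
    proof (cases "e = k")
      case True
      have r: "is_subring (rat_ring (insert k I) y)" by (rule is_subring_rat_ring)
      have "y k \<in> rat_ring (insert k I) y" by (simp add: rat_ring_generator)
      then have "[:- y k, 1:] \<in> polys_over (rat_ring (insert k I) y)"
        using r polys_over_closed(1)[OF r] unfolding polys_over_pCons is_subring_def by blast
      then show ?thesis unfolding algebraic_over_def True
        by (intro bexI[of _ "[:- y k, 1:]"]) auto
    next
      case False
      then show ?thesis
        using I(2) that by (intro algebraic_over_mono[OF rat_ring_mono[of I "insert k I" y]]) auto
    qed
    ultimately show ?thesis using I(1) by (intro exI[of _ "insert k I"]) auto
  qed
qed

section \<open>Solving perturbed equations\<close>

text \<open>Fixed-point iteration of \<open>k \<mapsto> c - q k\<close> from 0. On the box of radius
  \<open>2 * \<eta>\<close> the bound \<open>8 * B * \<eta> \<le> 1\<close> makes this map contract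
  by 1/2 and preserve the box; the increments are dominated by a geometric series.\<close>

lemma quadratic_perturbation_solution:
  fixes Q :: "'e \<Rightarrow> 'e \<Rightarrow> 'e \<Rightarrow> real" and c :: "'e \<Rightarrow> real"
  assumes I: "finite I" and B: "\<And>i. i \<in> I \<Longrightarrow> (\<Sum>a\<in>I. \<Sum>b\<in>I. \<bar>Q i a b\<bar>) \<le> B"
    and c: "\<And>i. i \<in> I \<Longrightarrow> \<bar>c i\<bar> \<le> \<eta>" and \<eta>: "8 * B * \<eta> \<le> 1" "0 \<le> B" "0 \<le> \<eta>"
  shows "\<exists>k. \<forall>i\<in>I. \<bar>k i\<bar> \<le> 2 * \<eta> \<and> k i + (\<Sum>a\<in>I. \<Sum>b\<in>I. Q i a b * (k a * k b)) = c i"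
proof -
  define q where "q k i = (\<Sum>a\<in>I. \<Sum>b\<in>I. Q i a b * (k a * k b))" for k :: "'e \<Rightarrow> real" and i
  \<comment> \<open>Lipschitz estimate for the quadratic part: each product changes by at most
    \<open>2 * \<eta> * \<delta>\<close> through either factor.\<close>
  have qd: "\<bar>q k i - q k' i\<bar> \<le> B * (4 * \<eta> * \<delta>)"
    if i: "i \<in> I" and k: "\<forall>a\<in>I. \<bar>k a\<bar> \<le> 2 * \<eta> \<and> \<bar>k' a\<bar> \<le> 2 * \<eta> \<and> \<bar>k a - k' a\<bar> \<le> \<delta>" and d: "0 \<le> \<delta>"
    for k k' i \<delta>
  proof -
    have "\<bar>q k i - q k' i\<bar> = \<bar>\<Sum>a\<in>I. \<Sum>b\<in>I. Q i a b * (k a * k b - k' a * k' b)\<bar>"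
      by (simp add: q_def sum_subtractf right_diff_distrib)
    also have "\<dots> \<le> (\<Sum>a\<in>I. \<Sum>b\<in>I. \<bar>Q i a b * (k a * k b - k' a * k' b)\<bar>)"
      by (intro order_trans[OF sum_abs] sum_mono sum_abs)
    also have "\<dots> \<le> (\<Sum>a\<in>I. \<Sum>b\<in>I. \<bar>Q i a b\<bar> * (4 * \<eta> * \<delta>))"
    proof (intro sum_mono)
      fix a b assume ab: "a \<in> I" "b \<in> I"
      have "\<bar>k a * k b - k' a * k' b\<bar> = \<bar>k a * (k b - k' b) + (k a - k' a) * k' b\<bar>"
        by (simp add: algebra_simps)
      also have "\<dots> \<le> \<bar>k a\<bar> * \<bar>k b - k' b\<bar> + \<bar>k a - k' a\<bar> * \<bar>k' b\<bar>"
        by (simp add: abs_mult[symmetric] abs_triangle_ineq)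
      also have "\<dots> \<le> 2 * \<eta> * \<delta> + \<delta> * (2 * \<eta>)"
        using k ab d \<eta> by (intro add_mono mult_mono) auto
      finally have "\<bar>k a * k b - k' a * k' b\<bar> \<le> 4 * \<eta> * \<delta>" by (simp add: mult_ac)
      then show "\<bar>Q i a b * (k a * k b - k' a * k' b)\<bar> \<le> \<bar>Q i a b\<bar> * (4 * \<eta> * \<delta>)"
        by (simp add: abs_mult mult_left_mono)
    qed
    also have "\<dots> = (\<Sum>a\<in>I. \<Sum>b\<in>I. \<bar>Q i a b\<bar>) * (4 * \<eta> * \<delta>)"
      by (simp add: sum_distrib_right)
    also have "\<dots> \<le> B * (4 * \<eta> * \<delta>)" using B[OF i] \<eta> d by (intro mult_right_mono) auto
    finally show ?thesis .
  qed
  have half: "B * (4 * \<eta> * \<delta>) \<le> \<delta> / 2" if "0 \<le> \<delta>" for \<delta>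
    using mult_right_mono[OF \<eta>(1), of "\<delta> / 2"] that by (simp add: algebra_simps)
  define g where "g n = ((\<lambda>k i. c i - q k i) ^^ n) (\<lambda>_. 0)" for n :: nat
  have g0: "g 0 i = 0" and gS: "g (Suc n) i = c i - q (g n) i" for n i by (simp_all add: g_def)
  have bd: "\<forall>i\<in>I. \<bar>g n i\<bar> \<le> 2 * \<eta>" for n
  proof (induction n)
    case 0 then show ?case using \<eta> by (simp add: g0)
  next
    case (Suc n)
    show ?case
    proof
      fix i assume i: "i \<in> I"
      have "\<bar>q (g n) i - q (\<lambda>_. 0) i\<bar> \<le> B * (4 * \<eta> * (2 * \<eta>))"
        using Suc \<eta> by (intro qd[OF i]) auto
      also have "\<dots> \<le> \<eta>" using half[of "2 * \<eta>"] \<eta> by simp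
      finally have "\<bar>q (g n) i\<bar> \<le> \<eta>" by (simp add: q_def)
      then show "\<bar>g (Suc n) i\<bar> \<le> 2 * \<eta>" using c[OF i] by (simp add: gS)
    qed
  qed
  have step: "\<forall>i\<in>I. \<bar>g (Suc n) i - g n i\<bar> \<le> 2 * \<eta> * (1 / 2) ^ n" for n
  proof (induction n)
    case 0 then show ?case using bd[of 1] by (simp add: g0)
  next
    case (Suc n)
    show ?case
    proof
      fix i assume i: "i \<in> I"
      have "\<bar>g (Suc (Suc n)) i - g (Suc n) i\<bar> = \<bar>q (g (Suc n)) i - q (g n) i\<bar>" by (simp add: gS)
      also have "\<dots> \<le> B * (4 * \<eta> * (2 * \<eta> * (1 / 2) ^ n))"
        using Suc bd \<eta> by (intro qd[OF i]) auto
      also have "\<dots> \<le> 2 * \<eta> * (1 / 2) ^ n / 2" using \<eta> by (intro half) auto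
      finally show "\<bar>g (Suc (Suc n)) i - g (Suc n) i\<bar> \<le> 2 * \<eta> * (1 / 2) ^ Suc n" by simp
    qed
  qed
  have "convergent (\<lambda>n. g n i)" if i: "i \<in> I" for i
  proof -
    have "summable (\<lambda>n. 2 * \<eta> * (1 / 2 :: real) ^ n)"
      by (intro summable_mult summable_geometric) simp
    then have "summable (\<lambda>n. g (Suc n) i - g n i)"
      by (rule summable_comparison_test') (use step i in auto)
    then have "convergent (\<lambda>n. \<Sum>m<n. g (Suc m) i - g m i)"
      by (simp add: summable_iff_convergent)
    then show ?thesis 
      using sum_lessThan_telescope[of "\<lambda>n. g n i"] by (simp add: g0)
  qed
  then obtain k where k: "\<And>i. i \<in> I \<Longrightarrow> (\<lambda>n. g n i) \<longlonglongrightarrow> k i"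
    unfolding convergent_def by metis
  show ?thesis
  proof (intro exI[of _ k] ballI conjI)
    fix i assume i: "i \<in> I"
    show "\<bar>k i\<bar> \<le> 2 * \<eta>"
      by (rule Lim_bounded[OF tendsto_rabs[OF k[OF i]], of 0]) (use bd i in auto)
    have "(\<lambda>n. q (g n) i) \<longlonglongrightarrow> q k i"
      unfolding q_def by (intro tendsto_intros k)
    then have "(\<lambda>n. g (Suc n) i) \<longlonglongrightarrow> c i - q k i"
      unfolding gS by (intro tendsto_intros)
    moreover have "(\<lambda>n. g (Suc n) i) \<longlonglongrightarrow> k i" using k[OF i] by (rule LIMSEQ_Suc)
    ultimately have "k i = c i - q k i" using LIMSEQ_unique by blast
    then show "k i + (\<Sum>a\<in>I. \<Sum>b\<in>I. Q i a b * (k a * k b)) = c i" by (simp add: q_def)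
  qed
qed

lemma quadratic_perturbation:
  fixes Q :: "'e \<Rightarrow> 'e \<Rightarrow> 'e \<Rightarrow> real" and c :: "nat \<Rightarrow> 'e \<Rightarrow> real"
  assumes I: "finite I" and c: "\<And>i. i \<in> I \<Longrightarrow> (\<lambda>n. c n i) \<longlonglongrightarrow> 0"
  shows "\<exists>k. (\<forall>i\<in>I. (\<lambda>n. k n i) \<longlonglongrightarrow> 0) \<and>
    (\<forall>\<^sub>F n in sequentially. \<forall>i\<in>I. k n i + (\<Sum>a\<in>I. \<Sum>b\<in>I. Q i a b * (k n a * k n b)) = c n i)"
proof -
  define B where "B = (\<Sum>i\<in>I. \<Sum>a\<in>I. \<Sum>b\<in>I. \<bar>Q i a b\<bar>)"
  have B: "(\<Sum>a\<in>I. \<Sum>b\<in>I. \<bar>Q i a b\<bar>) \<le> B" if "i \<in> I" for i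
    unfolding B_def
    by (rule member_le_sum[of i I "\<lambda>i. \<Sum>a\<in>I. \<Sum>b\<in>I. \<bar>Q i a b\<bar>"])
       (use that I in \<open>auto intro!: sum_nonneg\<close>)
  have B0: "0 \<le> B" unfolding B_def by (intro sum_nonneg) auto
  define \<eta> where "\<eta> n = (\<Sum>i\<in>I. \<bar>c n i\<bar>)" for n
  have \<eta>: "\<bar>c n i\<bar> \<le> \<eta> n" if "i \<in> I" for n i
    unfolding \<eta>_def by (rule member_le_sum[of i I "\<lambda>i. \<bar>c n i\<bar>"]) (use that I in auto)
  have \<eta>0: "0 \<le> \<eta> n" for n unfolding \<eta>_def by (intro sum_nonneg) auto
  have "\<eta> \<longlonglongrightarrow> (\<Sum>i\<in>I. \<bar>0\<bar>)" unfolding \<eta>_def by (intro tendsto_intros c)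
  then have \<eta>lim: "\<eta> \<longlonglongrightarrow> 0" by simp
  let ?P = "\<lambda>n k. \<forall>i\<in>I. \<bar>k i\<bar> \<le> 2 * \<eta> n \<and> k i + (\<Sum>a\<in>I. \<Sum>b\<in>I. Q i a b * (k a * k b)) = c n i"
  \<comment> \<open>For small \<open>n\<close> there may be no solution and the choice is arbitrary;
    the equations are needed only eventually, once \<open>8 * B * \<eta> n < 1\<close>.\<close>
  define k where "k n = (SOME k. ?P n k)" for n
  have "(\<lambda>n. 8 * B * \<eta> n) \<longlonglongrightarrow> 8 * B * 0" by (intro tendsto_intros \<eta>lim)
  then have "\<forall>\<^sub>F n in sequentially. 8 * B * \<eta> n < 1" by (rule order_tendstoD) simp
  then have ev: "\<forall>\<^sub>F n in sequentially. ?P n (k n)"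
  proof eventually_elim
    case (elim n)
    have "\<exists>k. ?P n k"
      by (rule quadratic_perturbation_solution[OF I, of Q B]) (use elim B B0 \<eta> \<eta>0 in auto)
    then show ?case unfolding k_def by (rule someI_ex)
  qed
  have "(\<lambda>n. k n i) \<longlonglongrightarrow> 0" if "i \<in> I" for i
  proof (rule tendsto_0_le[OF \<eta>lim])
    show "\<forall>\<^sub>F n in sequentially. norm (k n i) \<le> norm (\<eta> n) * 2"
      using ev by eventually_elim (use that \<eta>0 in auto)
  qed
  moreover have "\<forall>\<^sub>F n in sequentially.
      \<forall>i\<in>I. k n i + (\<Sum>a\<in>I. \<Sum>b\<in>I. Q i a b * (k n a * k n b)) = c n i"
    using ev by eventually_elim auto
  ultimately show ?thesis by blast
qed

text \<open>For linear functionals and finite \<open>I\<close> this is linear independence. Stated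
  as solvability, it directly supplies preimages of unit vectors.\<close>

definition jointly_onto :: "'e set \<Rightarrow> ('e \<Rightarrow> ('v \<Rightarrow> nat \<Rightarrow> real) \<Rightarrow> real) \<Rightarrow> bool" where
  "jointly_onto I L \<longleftrightarrow> (\<forall>c. \<exists>h. \<forall>e\<in>I. L e h = c e)"

text \<open>Gaussian elimination over the polynomials in the parameter \<open>\<tau>\<close>.\<close>

lemma jointly_onto_generic_parameter:
  fixes L :: "'e \<Rightarrow> ('v \<Rightarrow> nat \<Rightarrow> real) \<Rightarrow> real poly"
  assumes "finite I"
    and "\<And>e h g c. L e (\<lambda>v i. h v i + c * g v i) = L e h + smult c (L e g)"
    and "jointly_onto I (\<lambda>e h. poly (L e h) 0)"
  shows "finite {\<tau>. \<not> jointly_onto I (\<lambda>e h. poly (L e h) \<tau>)}"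
  using assms
proof (induction I arbitrary: L rule: finite_induct)
  case empty
  then show ?case by (simp add: jointly_onto_def)
next
  case (insert e0 F)
  note lin = insert.prems(1)
  note onto = insert.prems(2)[unfolded jointly_onto_def]
  obtain h0 where h0: "poly (L e0 h0) 0 = 1" using onto[rule_format, of "\<lambda>_. 1"] by auto
  \<comment> \<open>Elimination without division: \<open>h0\<close> is a pivot for
    \<open>e0\<close>, and every \<open>L' e\<close> vanishes at \<open>h0\<close>.\<close>
  define L' where "L' e h = L e0 h0 * L e h - L e h0 * L e0 h" for e h
  have lin': "L' e (\<lambda>v i. h v i + c * g v i) = L' e h + smult c (L' e g)" for e h g c
    by (simp add: L'_def lin algebra_simps smult_diff_right smult_add_right)
  have "jointly_onto F (\<lambda>e h. poly (L' e h) 0)"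
    unfolding jointly_onto_def
  proof
    fix c
    obtain h where h: "\<forall>e\<in>insert e0 F. poly (L e h) 0 = (if e = e0 then 0 else c e)"
      using onto[rule_format, of "\<lambda>e. if e = e0 then 0 else c e"] by blast
    have "\<forall>e\<in>F. poly (L' e h) 0 = c e"
      using h insert.hyps(2) by (auto simp: L'_def h0)
    then show "\<exists>h. \<forall>e\<in>F. poly (L' e h) 0 = c e" by blast
  qed
  from insert.IH[of L', OF lin' this]
  have "finite {\<tau>. \<not> jointly_onto F (\<lambda>e h. poly (L' e h) \<tau>)}" .
  moreover have "L e0 h0 \<noteq> 0" using h0 by auto
  then have "finite {\<tau>. poly (L e0 h0) \<tau> = 0}" by (rule poly_roots_finite)
  moreover have "jointly_onto (insert e0 F) (\<lambda>e h. poly (L e h) \<tau>)"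
    if on: "jointly_onto F (\<lambda>e h. poly (L' e h) \<tau>)" and nz: "poly (L e0 h0) \<tau> \<noteq> 0" for \<tau>
    unfolding jointly_onto_def
  proof
    fix c
    let ?a = "poly (L e0 h0) \<tau>"
    obtain h where h: "\<forall>e\<in>F. poly (L' e h) \<tau> = ?a * c e - poly (L e h0) \<tau> * c e0"
      using on[unfolded jointly_onto_def, rule_format, of "\<lambda>e. ?a * c e - poly (L e h0) \<tau> * c e0"]
      by blast
    \<comment> \<open>Moving along \<open>h0\<close> repairs the equation for \<open>e0\<close> and
      leaves the values of \<open>L'\<close> unchanged.\<close>
    define r where "r = (c e0 - poly (L e0 h) \<tau>) / ?a"
    define h1 where "h1 = (\<lambda>v i. h v i + r * h0 v i)"
    have Lh1: "poly (L e h1) \<tau> = poly (L e h) \<tau> + r * poly (L e h0) \<tau>" for e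
      by (simp add: h1_def lin)
    have "poly (L e h1) \<tau> = c e" if "e \<in> insert e0 F" for e
    proof (cases "e = e0")
      case True then show ?thesis using nz by (simp add: Lh1 r_def)
    next
      case False
      then have "?a * poly (L e h) \<tau> - poly (L e h0) \<tau> * poly (L e0 h) \<tau> = ?a * c e - poly (L e h0) \<tau> * c e0"
        using h that by (auto simp: L'_def)
      then have "?a * poly (L e h1) \<tau> = ?a * c e"
        using nz by (simp add: Lh1 r_def field_simps)
      then show ?thesis using nz by simp
    qed
    then show "\<exists>h. \<forall>e\<in>insert e0 F. poly (L e h) \<tau> = c e" by blast
  qed
  then have "{\<tau>. \<not> jointly_onto (insert e0 F) (\<lambda>e h. poly (L e h) \<tau>)} \<subseteq>
      {\<tau>. \<not> jointly_onto F (\<lambda>e h. poly (L' e h) \<tau>)} \<union> {\<tau>. poly (L e0 h0) \<tau> = 0}"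
    by blast
  ultimately show ?case using finite_subset by (metis (no_types, lifting) finite_UnI)
qed

lemma poly_pderiv_altdef: "poly (pderiv m) z = (\<Sum>k\<le>degree m. coeff m k * (of_nat k * z ^ (k - 1)))"
  for z :: real
proof (rule DERIV_unique[OF poly_DERIV])
  show "(poly m has_real_derivative (\<Sum>k\<le>degree m. coeff m k * (of_nat k * z ^ (k - 1)))) (at z)"
    unfolding poly_altdef[abs_def] by (auto intro!: derivative_eq_intros sum.cong)
qed

text \<open>Two distinct roots near \<open>a\<close> would force the divided difference
  \<open>K\<close> to vanish, but \<open>K\<close> tends to the derivative of \<open>m\<close> at
  \<open>a\<close>, which is nonzero.\<close>

lemma simple_root_unique:
  fixes H :: "nat \<Rightarrow> nat \<Rightarrow> real" and z z' :: "nat \<Rightarrow> real"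
  assumes H: "\<And>k. (\<lambda>n. H n k) \<longlonglongrightarrow> coeff m k"
    and z: "z \<longlonglongrightarrow> a" "z' \<longlonglongrightarrow> a" and simple: "poly (pderiv m) a \<noteq> 0"
    and root: "\<forall>\<^sub>F n in sequentially. (\<Sum>k\<le>degree m. H n k * z n ^ k) = 0 \<and>
      (\<Sum>k\<le>degree m. H n k * z' n ^ k) = 0"
  shows "\<forall>\<^sub>F n in sequentially. z n = z' n"
proof -
  \<comment> \<open>The divided difference is written as a polynomial, so it makes sense also where
    \<open>z n = z' n\<close>.\<close>
  define K where "K n = (\<Sum>k\<le>degree m. H n k * (\<Sum>j<k. z' n ^ (k - Suc j) * z n ^ j))" for n
  have "K \<longlonglongrightarrow> (\<Sum>k\<le>degree m. coeff m k * (\<Sum>j<k. a ^ (k - Suc j) * a ^ j))"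
    unfolding K_def by (intro tendsto_intros H z)
  also have "(\<Sum>k\<le>degree m. coeff m k * (\<Sum>j<k. a ^ (k - Suc j) * a ^ j)) = poly (pderiv m) a"
    unfolding poly_pderiv_altdef by (intro sum.cong) (auto simp flip: power_add)
  finally have "\<forall>\<^sub>F n in sequentially. K n \<noteq> 0" using simple by (rule tendsto_imp_eventually_ne)
  with root show ?thesis
  proof eventually_elim
    case (elim n)
    have "(z n - z' n) * K n = (\<Sum>k\<le>degree m. H n k * (z n ^ k - z' n ^ k))"
      unfolding K_def sum_distrib_left
      by (intro sum.cong) (simp_all add: power_diff_sumr2 sum_distrib_left mult_ac)
    also have "\<dots> = 0" using elim by (simp add: right_diff_distrib sum_subtractf)
    finally show ?case using elim by simp
  qed
qed

section \<open>Pairs of equivalent frameworks\<close>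

text \<open>The polarization of the squared edge length. As a function of \<open>q\<close> it is
  half the derivative of the length at \<open>p\<close>, that is, row \<open>e\<close> of the
  rigidity matrix up to the factor 2. A sign function in place of \<open>s\<close> allows any single
  sign to be flipped.\<close>

definition edge_form ::
  "(nat \<Rightarrow> real) \<Rightarrow> nat \<Rightarrow> ('v \<Rightarrow> nat \<Rightarrow> real) \<Rightarrow> ('v \<Rightarrow> nat \<Rightarrow> real) \<Rightarrow> 'v \<times> 'v \<Rightarrow> real" where
  "edge_form \<epsilon> d p q e =
     (\<Sum>i<d. \<epsilon> i * ((p (fst e) i - p (snd e) i) * (q (fst e) i - q (snd e) i)))"

abbreviation sq_dist :: "(nat \<Rightarrow> real) \<Rightarrow> nat \<Rightarrow> ('v \<Rightarrow> nat \<Rightarrow> real) \<Rightarrow> 'v \<times> 'v \<Rightarrow> real" where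
  "sq_dist \<epsilon> d p \<equiv> edge_form \<epsilon> d p p"

lemma edge_form_commute: "edge_form \<epsilon> d p q = edge_form \<epsilon> d q p"
  by (simp add: edge_form_def fun_eq_iff mult.commute)

lemma edge_form_add_right:
  "edge_form \<epsilon> d p (\<lambda>v i. q v i + c * r v i) e = edge_form \<epsilon> d p q e + c * edge_form \<epsilon> d p r e"
  unfolding edge_form_def sum_distrib_left sum.distrib[symmetric]
  by (intro sum.cong) (auto simp: algebra_simps)

lemma edge_form_sum_right:
  "edge_form \<epsilon> d p (\<lambda>v i. \<Sum>a\<in>I. c a * M a v i) e = (\<Sum>a\<in>I. c a * edge_form \<epsilon> d p (M a) e)"
proof (induction I rule: infinite_finite_induct)
  case (insert x F)
  have "(\<lambda>v i. \<Sum>a\<in>insert x F. c a * M a v i) = (\<lambda>v i. (\<Sum>a\<in>F. c a * M a v i) + c x * M x v i)"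
    using insert by (simp add: add.commute)
  then show ?case using insert by (simp add: edge_form_add_right)
qed (auto simp: edge_form_def)

text \<open>The exact Taylor expansion of a quadratic form, arranged so that its last sum is the
  quadratic term of \<open>quadratic_perturbation\<close>.\<close>

lemma sq_dist_add_sum:
  "sq_dist \<epsilon> d (\<lambda>v i. p v i + (\<Sum>a\<in>I. c a * M a v i)) e =
     sq_dist \<epsilon> d p e + (\<Sum>a\<in>I. c a * (2 * edge_form \<epsilon> d p (M a) e)) +
     (\<Sum>a\<in>I. \<Sum>b\<in>I. edge_form \<epsilon> d (M a) (M b) e * (c a * c b))"
proof -
  define h where "h = (\<lambda>v i. \<Sum>a\<in>I. c a * M a v i)"
  have "sq_dist \<epsilon> d (\<lambda>v i. p v i + 1 * h v i) e =
      sq_dist \<epsilon> d p e + 2 * edge_form \<epsilon> d p h e + edge_form \<epsilon> d h h e"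
    unfolding edge_form_add_right by (subst (1 2) edge_form_commute) (simp only: edge_form_add_right, simp add: edge_form_commute)
  moreover have "edge_form \<epsilon> d h h e = (\<Sum>b\<in>I. c b * (\<Sum>a\<in>I. c a * edge_form \<epsilon> d (M b) (M a) e))"
    unfolding h_def by (subst edge_form_sum_right, subst edge_form_commute, subst edge_form_sum_right) simp
  moreover have "edge_form \<epsilon> d p h e = (\<Sum>a\<in>I. c a * edge_form \<epsilon> d p (M a) e)"
    unfolding h_def by (rule edge_form_sum_right)
  ultimately show ?thesis
    by (simp add: h_def sum_distrib_left mult_ac)
qed

lemma sq_dist_rat_polys:
  assumes "e \<in> V \<times> V" "\<forall>i. \<epsilon> i \<in> {1, -1}"
  shows "(\<lambda>x. sq_dist \<epsilon> d (\<lambda>v i. x (v, i)) e) \<in> rat_polys (V \<times> {..<d})"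
  unfolding edge_form_def
proof (intro rat_polys_sum rat_polys_mult rat_polys_diff rat_polys_var rat_polys_const)
  show "\<epsilon> i \<in> \<rat>" for i using assms(2)[rule_format, of i] by auto
qed (use assms in auto)

lemma tendsto_edge_form:
  assumes "e \<in> V \<times> V" "\<And>v i. v \<in> V \<Longrightarrow> i < d \<Longrightarrow> (\<lambda>n. p n v i) \<longlonglongrightarrow> p' v i"
    "\<And>v i. v \<in> V \<Longrightarrow> i < d \<Longrightarrow> (\<lambda>n. q n v i) \<longlonglongrightarrow> q' v i"
  shows "(\<lambda>n. edge_form \<epsilon> d (p n) (q n) e) \<longlonglongrightarrow> edge_form \<epsilon> d p' q' e"
  unfolding edge_form_def by (intro tendsto_intros assms) (use assms in auto)

text \<open>A derivation dual to a transcendence basis of the edge lengths, applied to the coordinates,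
  gives a right inverse of the corresponding rows of the rigidity matrix.\<close>

lemma edge_transcendence_basis:
  fixes \<rho> :: "'v \<Rightarrow> nat \<Rightarrow> real"
  assumes V: "finite V" and K: "K \<subseteq> V \<times> V" and \<epsilon>: "\<forall>i. \<epsilon> i \<in> {1, -1}"
  shows "\<exists>I\<subseteq>K. (\<forall>e\<in>K. algebraic_over (rat_ring I (sq_dist \<epsilon> d \<rho>)) (sq_dist \<epsilon> d \<rho> e)) \<and>
    jointly_onto I (\<lambda>e h. edge_form \<epsilon> d \<rho> h e)"
proof -
  let ?y = "sq_dist \<epsilon> d \<rho>"
  have "finite K" using K V finite_subset by blast
  from transcendence_basis_derivations[OF this, of ?y]
  obtain I where I: "I \<subseteq> K" "\<forall>e\<in>K. algebraic_over (rat_ring I ?y) (?y e)"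
    "\<forall>e\<in>I. \<exists>D. derivation_on (rat_ring I ?y) D \<and> (\<forall>e'\<in>I. D (?y e') = (if e' = e then 1 else 0))"
    by blast
  have finI: "finite I" using I(1) \<open>finite K\<close> finite_subset by blast
  have "\<exists>M. \<forall>e'\<in>I. 2 * edge_form \<epsilon> d \<rho> M e' = (if e' = e then 1 else 0)" if e: "e \<in> I" for e
  proof -
    obtain D where D: "derivation_on (rat_ring I ?y) D" "\<forall>e'\<in>I. D (?y e') = (if e' = e then 1 else 0)"
      using I(3) e by blast
    \<comment> \<open>The edge lengths generate a ring that need not contain the coordinates;
      extending \<open>D\<close> to the coordinates makes the product rule applicable to each
      summand of a length.\<close>
    have "finite ((\<lambda>(v, i). \<rho> v i) ` (V \<times> {..<d}))" using V by simp
    from derivation_extend_finite[OF this is_subring_rat_ring D(1)]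
    obtain A D' where A: "is_subring A" "rat_ring I ?y \<union> (\<lambda>(v, i). \<rho> v i) ` (V \<times> {..<d}) \<subseteq> A"
      and D': "derivation_on A D'" "\<forall>b\<in>rat_ring I ?y. D' b = D b"
      by blast
    have \<rho>A: "\<rho> v i \<in> A" if "v \<in> V" "i < d" for v i using A(2) that by force
    have \<epsilon>A: "\<epsilon> i \<in> A" "D' (\<epsilon> i) = 0" for i
      using \<epsilon>[rule_format, of i] A(1) derivation_1[OF A(1) D'(1)] derivation_minus[OF A(1) D'(1), of 1]
      by (auto simp: is_subring_def)
    have mA: "a * b \<in> A" and Dm: "D' (a * b) = a * D' b + b * D' a" if "a \<in> A" "b \<in> A" for a b
      using A(1) D'(1) that unfolding is_subring_def derivation_on_def by auto
    define M where "M v i = D' (\<rho> v i)" for v i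
    have "2 * edge_form \<epsilon> d \<rho> M e' = (if e' = e then 1 else 0)" if e': "e' \<in> I" for e'
    proof -
      obtain t u where tu: "e' = (t, u)" "t \<in> V" "u \<in> V" using e' I(1) K by blast
      have dA: "\<rho> t i - \<rho> u i \<in> A" if "i < d" for i
        using subring_diff[OF A(1)] \<rho>A tu that by blast
      have "?y e' \<in> rat_ring I ?y" by (rule rat_ring_generator[OF e'])
      then have "D' (?y e') = (if e' = e then 1 else 0)" using D'(2) D(2) e' by simp
      also have "D' (?y e') = (\<Sum>i<d. D' (\<epsilon> i * ((\<rho> t i - \<rho> u i) * (\<rho> t i - \<rho> u i))))"
        unfolding edge_form_def tu fst_conv snd_conv
        by (rule derivation_sum[OF A(1) D'(1)]) (use dA mA \<epsilon>A in auto)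
      also have "\<dots> = (\<Sum>i<d. 2 * (\<epsilon> i * ((\<rho> t i - \<rho> u i) * (M t i - M u i))))"
        by (intro sum.cong)
           (use dA mA \<epsilon>A \<rho>A tu in \<open>auto simp: Dm derivation_diff[OF A(1) D'(1)] M_def\<close>)
      also have "\<dots> = 2 * edge_form \<epsilon> d \<rho> M e'"
        by (simp add: edge_form_def tu sum_distrib_left)
      finally show ?thesis by simp
    qed
    then show ?thesis by blast
  qed
  then obtain M where M: "\<And>e e'. e \<in> I \<Longrightarrow> e' \<in> I \<Longrightarrow> 2 * edge_form \<epsilon> d \<rho> (M e) e' = (if e' = e then 1 else 0)"
    by metis
  have "\<exists>h. \<forall>e\<in>I. edge_form \<epsilon> d \<rho> h e = c e" for c :: "'v \<times> 'v \<Rightarrow> real"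
  proof (intro exI ballI)
    fix e assume e: "e \<in> I"
    have "edge_form \<epsilon> d \<rho> (\<lambda>v i. \<Sum>a\<in>I. (2 * c a) * M a v i) e = (\<Sum>a\<in>I. c a * (2 * edge_form \<epsilon> d \<rho> (M a) e))"
      unfolding edge_form_sum_right by (intro sum.cong) auto
    also have "\<dots> = (\<Sum>a\<in>I. if a = e then c a else 0)"
      by (intro sum.cong) (use M e in auto)
    also have "\<dots> = c e" using e finI by simp
    finally show "edge_form \<epsilon> d \<rho> (\<lambda>v i. \<Sum>a\<in>I. (2 * c a) * M a v i) e = c e" .
  qed
  then show ?thesis using I(1,2) unfolding jointly_onto_def by blast
qed

text \<open>The relation satisfied by the length of \<open>e\<close> holds at the generic
  \<open>\<rho>\<close>, hence for all frameworks. Since \<open>p n\<close> and \<open>q n\<close>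
  agree on \<open>I\<close>, their lengths of \<open>e\<close> are roots of one polynomial, both
  tending to the same simple root.\<close>

lemma algebraic_edge_determined:
  fixes \<rho> \<sigma> :: "'v \<Rightarrow> nat \<Rightarrow> real"
  assumes V: "finite V" and \<rho>: "generic_fw d V \<rho>" and \<epsilon>: "\<forall>i. \<epsilon> i \<in> {1, -1}"
    and I: "I \<subseteq> V \<times> V" and e: "e \<in> V \<times> V"
    and alg: "algebraic_over (rat_ring I (sq_dist \<epsilon> d \<rho>)) (sq_dist \<epsilon> d \<rho> e)"
    and eq: "sq_dist \<epsilon> d \<rho> e = sq_dist \<epsilon> d \<sigma> e"
    and p: "\<And>v i. v \<in> V \<Longrightarrow> i < d \<Longrightarrow> (\<lambda>n. p n v i) \<longlonglongrightarrow> \<rho> v i"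
    and q: "\<And>v i. v \<in> V \<Longrightarrow> i < d \<Longrightarrow> (\<lambda>n. q n v i) \<longlonglongrightarrow> \<sigma> v i"
    and pq: "\<forall>\<^sub>F n in sequentially. \<forall>e\<in>I. sq_dist \<epsilon> d (p n) e = sq_dist \<epsilon> d (q n) e"
  shows "\<forall>\<^sub>F n in sequentially. sq_dist \<epsilon> d (p n) e = sq_dist \<epsilon> d (q n) e"
proof -
  let ?y = "sq_dist \<epsilon> d \<rho>"
  obtain m where m: "m \<in> polys_over (rat_ring I ?y)" "poly m (?y e) = 0" "poly (pderiv m) (?y e) \<noteq> 0"
    using algebraic_over_minimal[OF is_subring_rat_ring alg] by metis
  then have "\<forall>k. \<exists>g. g \<in> rat_polys I \<and> coeff m k = g ?y" by (auto simp: polys_over_def rat_ring_def)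
  then obtain H where H: "\<And>k. H k \<in> rat_polys I" "\<And>k. coeff m k = H k ?y" by metis
  \<comment> \<open>The relation with all lengths expanded in the coordinates, so that genericity of
    \<open>\<rho>\<close> applies.\<close>
  define G where "G = (\<lambda>x. \<Sum>k\<le>degree m. H k (sq_dist \<epsilon> d (\<lambda>v i. x (v, i))) * sq_dist \<epsilon> d (\<lambda>v i. x (v, i)) e ^ k)"
  have "G \<in> rat_polys (V \<times> {..<d})"
    unfolding G_def
    by (intro rat_polys_sum rat_polys_mult rat_polys_power sq_dist_rat_polys[OF e \<epsilon>]
        rat_polys_compose[OF H(1), of "\<lambda>x. sq_dist \<epsilon> d (\<lambda>v i. x (v, i))"] sq_dist_rat_polys[OF _ \<epsilon>])
       (use I in auto)
  moreover have "G (\<lambda>(v, i). \<rho> v i) = 0"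
    using m(2) by (simp add: G_def poly_altdef H(2))
  ultimately have "G x = 0" for x
    using rat_polys_eq_0_if_generic_root[of "V \<times> {..<d}" "\<lambda>(v, i). \<rho> v i" G x] V \<rho>
    unfolding generic_fw_def by auto
  from this[of "\<lambda>(v, i). r v i" for r]
  have G0: "(\<Sum>k\<le>degree m. H k (sq_dist \<epsilon> d r) * sq_dist \<epsilon> d r e ^ k) = 0" for r
    by (simp add: G_def)
  show ?thesis
  proof (rule simple_root_unique[where H = "\<lambda>n k. H k (sq_dist \<epsilon> d (p n))", OF _ _ _ m(3)])
    show "(\<lambda>n. H k (sq_dist \<epsilon> d (p n))) \<longlonglongrightarrow> coeff m k" for k
      unfolding H(2) by (rule tendsto_rat_polys[OF H(1)], rule tendsto_edge_form[where V = V]) (use p I in auto)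
    show "(\<lambda>n. sq_dist \<epsilon> d (p n) e) \<longlonglongrightarrow> ?y e" by (rule tendsto_edge_form[OF e]) (use p in auto)
    show "(\<lambda>n. sq_dist \<epsilon> d (q n) e) \<longlonglongrightarrow> ?y e"
      unfolding eq by (rule tendsto_edge_form[OF e]) (use q in auto)
    show "\<forall>\<^sub>F n in sequentially.
        (\<Sum>k\<le>degree m. H k (sq_dist \<epsilon> d (p n)) * sq_dist \<epsilon> d (p n) e ^ k) = 0 \<and>
        (\<Sum>k\<le>degree m. H k (sq_dist \<epsilon> d (p n)) * sq_dist \<epsilon> d (q n) e ^ k) = 0"
      using pq
    proof eventually_elim
      case (elim n)
      then have "H k (sq_dist \<epsilon> d (p n)) = H k (sq_dist \<epsilon> d (q n))" for k
        by (intro rat_polys_cong[OF H(1)]) auto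
      then show ?case using G0[of "p n"] G0[of "q n"] by simp
    qed
  qed
qed

section \<open>Flipping one sign of the form\<close>

text \<open>A counterexample to generic global rigidity, for an arbitrary sign vector.\<close>

definition flexible_pair ::
  "(nat \<Rightarrow> real) \<Rightarrow> nat \<Rightarrow> 'v set \<Rightarrow> ('v \<times> 'v) set \<Rightarrow> ('v \<Rightarrow> nat \<Rightarrow> real) \<Rightarrow> ('v \<Rightarrow> nat \<Rightarrow> real) \<Rightarrow> bool"
  where "flexible_pair \<epsilon> d V K \<rho> \<sigma> \<longleftrightarrow> generic_fw d V \<rho> \<and>
    (\<forall>e\<in>K. sq_dist \<epsilon> d \<rho> e = sq_dist \<epsilon> d \<sigma> e) \<and> (\<exists>e\<in>V \<times> V. sq_dist \<epsilon> d \<rho> e \<noteq> sq_dist \<epsilon> d \<sigma> e)"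

text \<open>The pair \<open>(mix k \<tau> p q, mix k \<tau> q p)\<close> arises from \<open>(p, q)\<close> by a hyperbolic rotation of
  the \<open>k\<close>-th coordinates followed by exchanging them, which flips the \<open>k\<close>-th sign of the form.\<close>

definition mix :: "nat \<Rightarrow> real \<Rightarrow> ('v \<Rightarrow> nat \<Rightarrow> real) \<Rightarrow> ('v \<Rightarrow> nat \<Rightarrow> real) \<Rightarrow> 'v \<Rightarrow> nat \<Rightarrow> real" where
  "mix k \<tau> p q v i = (if i = k then (\<tau> * q v k - p v k) / sqrt (\<tau>\<^sup>2 - 1) else p v i)"

text \<open>Only coordinate \<open>k\<close> changes. There the identity \<open>key\<close> turns
  the difference of squares into its negative, which the flipped sign absorbs.\<close>

lemma sq_dist_mix:
  assumes "1 < \<tau>"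
  shows "sq_dist \<epsilon> d (mix k \<tau> p q) e - sq_dist \<epsilon> d (mix k \<tau> q p) e =
    sq_dist (\<epsilon>(k := - \<epsilon> k)) d p e - sq_dist (\<epsilon>(k := - \<epsilon> k)) d q e"
proof -
  have pos: "\<tau>\<^sup>2 - 1 > 0" using assms by (simp add: one_less_power)
  have key: "((\<tau> * b - a) / sqrt (\<tau>\<^sup>2 - 1))\<^sup>2 - ((\<tau> * a - b) / sqrt (\<tau>\<^sup>2 - 1))\<^sup>2 = b\<^sup>2 - a\<^sup>2" for a b
  proof -
    have "(\<tau> * b - a)\<^sup>2 - (\<tau> * a - b)\<^sup>2 = (\<tau>\<^sup>2 - 1) * (b\<^sup>2 - a\<^sup>2)"
      by (simp add: power2_eq_square algebra_simps)
    then show ?thesis using pos by (simp add: power_divide flip: diff_divide_distrib)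
  qed
  obtain t u where e: "e = (t, u)" by (cases e)
  have dm: "mix k \<tau> p q t k - mix k \<tau> p q u k = (\<tau> * (q t k - q u k) - (p t k - p u k)) / sqrt (\<tau>\<^sup>2 - 1)" for p q
    by (simp add: mix_def algebra_simps diff_divide_distrib add_divide_distrib)
  show ?thesis
    unfolding edge_form_def sum_subtractf[symmetric] e fst_conv snd_conv power2_eq_square[symmetric]
  proof (intro sum.cong refl)
    fix i
    show "\<epsilon> i * (mix k \<tau> p q t i - mix k \<tau> p q u i)\<^sup>2 - \<epsilon> i * (mix k \<tau> q p t i - mix k \<tau> q p u i)\<^sup>2 =
      (\<epsilon>(k := - \<epsilon> k)) i * (p t i - p u i)\<^sup>2 - (\<epsilon>(k := - \<epsilon> k)) i * (q t i - q u i)\<^sup>2"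
    proof (cases "i = k")
      case True
      show ?thesis unfolding True dm right_diff_distrib[symmetric] key by (simp add: algebra_simps)
    next
      case False then show ?thesis by (simp add: mix_def)
    qed
  qed
qed

lemma flexible_pair_flip_sign:
  fixes \<rho> \<sigma> :: "'v \<Rightarrow> nat \<Rightarrow> real"
  assumes V: "finite V" and K: "K \<subseteq> V \<times> V" and \<epsilon>: "\<forall>i. \<epsilon> i \<in> {1, -1}" and k: "k < d"
    and fp: "flexible_pair \<epsilon> d V K \<rho> \<sigma>"
  shows "\<exists>\<rho>' \<sigma>'. flexible_pair (\<epsilon>(k := - \<epsilon> k)) d V K \<rho>' \<sigma>'"
proof -
  define \<epsilon>' where "\<epsilon>' = \<epsilon>(k := - \<epsilon> k)"
  have gen: "generic_fw d V \<rho>" and eqv: "\<forall>e\<in>K. sq_dist \<epsilon> d \<rho> e = sq_dist \<epsilon> d \<sigma> e"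
    using fp by (auto simp: flexible_pair_def)
  obtain e1 where e1: "e1 \<in> V \<times> V" "sq_dist \<epsilon> d \<rho> e1 \<noteq> sq_dist \<epsilon> d \<sigma> e1"
    using fp by (auto simp: flexible_pair_def)
  have finK: "finite K" using K V finite_subset by blast
  from edge_transcendence_basis[OF V K \<epsilon>, of d \<rho>]
  obtain I where I: "I \<subseteq> K" "\<forall>e\<in>K. algebraic_over (rat_ring I (sq_dist \<epsilon> d \<rho>)) (sq_dist \<epsilon> d \<rho> e)"
    "jointly_onto I (\<lambda>e h. edge_form \<epsilon> d \<rho> h e)"
    by blast
  have finI: "finite I" using I(1) finK finite_subset by blast
  \<comment> \<open>At parameter \<tau> this is row \<open>e\<close> of the rigidity matrix at
    \<open>P\<close>, up to a rescaling of coordinate \<open>k\<close> of \<open>h\<close>; at 0 it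
    is the row at \<rho>.\<close>
  define L where "L e h = [:edge_form \<epsilon> d \<rho> h e,
      \<epsilon> k * ((\<sigma> (fst e) k - \<sigma> (snd e) k) * (h (fst e) k - h (snd e) k)):]" for e and h :: "'v \<Rightarrow> nat \<Rightarrow> real"
  have "finite {\<tau>. \<not> jointly_onto I (\<lambda>e h. poly (L e h) \<tau>)}"
  proof (rule jointly_onto_generic_parameter[OF finI])
    show "L e (\<lambda>v i. h v i + c * g v i) = L e h + smult c (L e g)" for e h g c
      by (simp add: L_def edge_form_add_right algebra_simps)
    show "jointly_onto I (\<lambda>e h. poly (L e h) 0)" using I(3) by (simp add: L_def)
  qed
  then have "infinite ({1<..} - {\<tau>. \<not> jointly_onto I (\<lambda>e h. poly (L e h) \<tau>)})"
    by (simp add: infinite_Ioi Diff_infinite_finite)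
  then obtain \<tau> where \<tau>: "1 < \<tau>" "jointly_onto I (\<lambda>e h. poly (L e h) \<tau>)"
    by (metis (mono_tags, lifting) Diff_iff finite.emptyI greaterThan_iff mem_Collect_eq ex_in_conv)
  define w where "w = sqrt (\<tau>\<^sup>2 - 1)"
  have w: "w > 0" "w\<^sup>2 = \<tau>\<^sup>2 - 1" using \<tau>(1) by (simp_all add: w_def one_less_power)
  \<comment> \<open>\<open>P\<close> and \<open>S\<close> are chosen so that mixing them gives back
    \<open>\<rho>\<close> and \<open>\<sigma>\<close>.\<close>
  define P where "P v i = (if i = k then (\<rho> v k + \<tau> * \<sigma> v k) / w else \<rho> v i)" for v i
  define S where "S v i = (if i = k then (\<tau> * \<rho> v k + \<sigma> v k) / w else \<sigma> v i)" for v i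
  have cancel: "(\<tau> * ((\<tau> * a + b) / w) - (a + \<tau> * b) / w) / w = a" for a b
  proof -
    have "(\<tau> * ((\<tau> * a + b) / w) - (a + \<tau> * b) / w) / w = (\<tau>\<^sup>2 - 1) * a / w\<^sup>2"
      using w(1) by (simp add: field_simps power2_eq_square)
    then show ?thesis using w(1) by (simp flip: w(2))
  qed
  have mixP: "mix k \<tau> P S = \<rho>" and mixS: "mix k \<tau> S P = \<sigma>"
    using cancel[of "\<rho> v k" "\<sigma> v k" for v] cancel[of "\<sigma> v k" "\<rho> v k" for v]
    by (auto simp: fun_eq_iff mix_def P_def S_def add.commute simp flip: w_def)
  have onto: "jointly_onto I (\<lambda>e h. edge_form \<epsilon>' d P h e)"
    unfolding jointly_onto_def
  proof
    fix c
    obtain h where h: "\<forall>e\<in>I. poly (L e h) \<tau> = c e" using \<tau>(2) unfolding jointly_onto_def by blast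
    \<comment> \<open>The factor \<open>- w\<close> cancels both the flipped sign and the
      denominator of \<open>P\<close> in coordinate \<open>k\<close>.\<close>
    define h' where "h' v i = (if i = k then - w * h v k else h v i)" for v i
    have "edge_form \<epsilon>' d P h' (t, u) = poly (L (t, u) h) \<tau>" for t u
    proof -
      have "\<epsilon>' i * ((P t i - P u i) * (h' t i - h' u i)) = \<epsilon> i * ((\<rho> t i - \<rho> u i) * (h t i - h u i)) +
          (if i = k then \<tau> * (\<epsilon> k * ((\<sigma> t k - \<sigma> u k) * (h t k - h u k))) else 0)" for i
        using w(1) by (simp add: \<epsilon>'_def P_def h'_def field_simps)
      then show ?thesis
        using k by (simp add: edge_form_def L_def sum.distrib)
    qed
    then have "\<forall>e\<in>I. edge_form \<epsilon>' d P h' e = c e" using h by auto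
    then show "\<exists>h. \<forall>e\<in>I. edge_form \<epsilon>' d P h e = c e" by blast
  qed
  \<comment> \<open>The value 1/2 offsets the factor 2 in \<open>sq_dist_add_sum\<close>, so the
    linear part of the length equations becomes the identity.\<close>
  have "\<exists>M. \<forall>e'\<in>I. edge_form \<epsilon>' d P M e' = (if e' = e then 1 / 2 else 0)" for e
    using onto[unfolded jointly_onto_def, rule_format, of "\<lambda>e'. if e' = e then 1 / 2 else 0"] .
  then obtain M where M: "\<And>e e'. e' \<in> I \<Longrightarrow> edge_form \<epsilon>' d P (M e) e' = (if e' = e then 1 / 2 else 0)"
    by metis
  obtain X where X: "\<And>n. alg_indep_Q (V \<times> {..<d}) (X n)"
    "\<And>z. (\<lambda>n. X n z) \<longlonglongrightarrow> (\<lambda>(v, i). S v i) z"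
    using generic_approximation[of "V \<times> {..<d}" "\<lambda>(v, i). \<rho> v i" "\<lambda>(v, i). S v i"] V gen
    unfolding generic_fw_def by auto
  define Sn where "Sn n v i = X n (v, i)" for n v i
  have Sgen: "generic_fw d V (Sn n)" for n using X(1)[of n] by (simp add: generic_fw_def Sn_def)
  have Slim: "(\<lambda>n. Sn n v i) \<longlonglongrightarrow> S v i" for v i using X(2)[of "(v, i)"] by (simp add: Sn_def)
  have PS: "sq_dist \<epsilon>' d P e - sq_dist \<epsilon>' d S e = sq_dist \<epsilon> d \<rho> e - sq_dist \<epsilon> d \<sigma> e" for e
    using sq_dist_mix[OF \<tau>(1), of \<epsilon> d k P S e] by (simp add: mixP mixS \<epsilon>'_def)
  define c where "c n e = sq_dist \<epsilon>' d (Sn n) e - sq_dist \<epsilon>' d P e" for n e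
  have "(\<lambda>n. c n e) \<longlonglongrightarrow> 0" if e: "e \<in> I" for e
  proof -
    have "(\<lambda>n. c n e) \<longlonglongrightarrow> sq_dist \<epsilon>' d S e - sq_dist \<epsilon>' d P e"
      unfolding c_def
      by (intro tendsto_intros tendsto_edge_form[where V = V]) (use Slim e I(1) K in auto)
    moreover have "sq_dist \<epsilon>' d S e - sq_dist \<epsilon>' d P e = 0" using PS[of e] eqv e I(1) by auto
    ultimately show ?thesis by simp
  qed
  \<comment> \<open>The coefficients \<open>\<kappa>\<close> correct \<open>P\<close> to
    \<open>Pn\<close>, which matches the lengths of the generic \<open>Sn\<close> on
    \<open>I\<close>.\<close>
  from quadratic_perturbation[where c = c, OF finI this, where Q = "\<lambda>e a b. edge_form \<epsilon>' d (M a) (M b) e"]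
  obtain \<kappa> where \<kappa>: "\<forall>e\<in>I. (\<lambda>n. \<kappa> n e) \<longlonglongrightarrow> 0"
    "\<forall>\<^sub>F n in sequentially. \<forall>e\<in>I. \<kappa> n e + (\<Sum>a\<in>I. \<Sum>b\<in>I. edge_form \<epsilon>' d (M a) (M b) e * (\<kappa> n a * \<kappa> n b)) = c n e"
    by blast
  define Pn where "Pn n = (\<lambda>v i. P v i + (\<Sum>a\<in>I. \<kappa> n a * M a v i))" for n
  have Plim: "(\<lambda>n. Pn n v i) \<longlonglongrightarrow> P v i" for v i
  proof -
    have "(\<lambda>n. Pn n v i) \<longlonglongrightarrow> P v i + (\<Sum>a\<in>I. 0 * M a v i)"
      unfolding Pn_def by (intro tendsto_intros) (use \<kappa> in auto)
    then show ?thesis by simp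
  qed
  have PSI: "\<forall>\<^sub>F n in sequentially. \<forall>e\<in>I. sq_dist \<epsilon>' d (Pn n) e = sq_dist \<epsilon>' d (Sn n) e"
    using \<kappa>(2)
  proof eventually_elim
    case (elim n)
    show ?case
    proof
      fix e assume e: "e \<in> I"
      have "(\<Sum>a\<in>I. \<kappa> n a * (2 * edge_form \<epsilon>' d P (M a) e)) = (\<Sum>a\<in>I. if a = e then \<kappa> n a else 0)"
        by (intro sum.cong) (auto simp: M[OF e])
      then have "(\<Sum>a\<in>I. \<kappa> n a * (2 * edge_form \<epsilon>' d P (M a) e)) = \<kappa> n e" using e finI by simp
      then show "sq_dist \<epsilon>' d (Pn n) e = sq_dist \<epsilon>' d (Sn n) e"
        using elim e by (simp add: Pn_def sq_dist_add_sum c_def algebra_simps)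
    qed
  qed
  have mixlim: "(\<lambda>n. mix k \<tau> (p n) (q n) v i) \<longlonglongrightarrow> mix k \<tau> p' q' v i"
    if "\<And>v i. (\<lambda>n. p n v i) \<longlonglongrightarrow> p' v i" "\<And>v i. (\<lambda>n. q n v i) \<longlonglongrightarrow> q' v i"
    for p q p' q' and v :: 'v and i
    unfolding mix_def using that w(1)
    by (auto intro!: tendsto_intros simp flip: w_def)
  have tr: "sq_dist \<epsilon> d (mix k \<tau> (Pn n) (Sn n)) e = sq_dist \<epsilon> d (mix k \<tau> (Sn n) (Pn n)) e \<longleftrightarrow>
      sq_dist \<epsilon>' d (Pn n) e = sq_dist \<epsilon>' d (Sn n) e" for n e
    using sq_dist_mix[OF \<tau>(1), of \<epsilon> d k "Pn n" "Sn n" e] by (auto simp: \<epsilon>'_def)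
  \<comment> \<open>For the edges outside \<open>I\<close> the pair is mixed back to one converging
    to \<open>(\<rho>, \<sigma>)\<close>, where the algebraic dependence on \<open>I\<close> is
    available.\<close>
  have "\<forall>\<^sub>F n in sequentially. sq_dist \<epsilon>' d (Pn n) e = sq_dist \<epsilon>' d (Sn n) e" if e: "e \<in> K" for e
    unfolding tr[symmetric]
  proof (rule algebraic_edge_determined[OF V gen \<epsilon>, of I])
    show "\<forall>\<^sub>F n in sequentially. \<forall>e\<in>I. sq_dist \<epsilon> d (mix k \<tau> (Pn n) (Sn n)) e =
        sq_dist \<epsilon> d (mix k \<tau> (Sn n) (Pn n)) e"
      using PSI by (simp add: tr)
    show "(\<lambda>n. mix k \<tau> (Pn n) (Sn n) v i) \<longlonglongrightarrow> \<rho> v i" for v i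
      using mixlim[of Pn P Sn S v i] Plim Slim by (simp add: mixP)
    show "(\<lambda>n. mix k \<tau> (Sn n) (Pn n) v i) \<longlonglongrightarrow> \<sigma> v i" for v i
      using mixlim[of Sn S Pn P v i] Plim Slim by (simp add: mixS)
  qed (use I K e eqv in auto)
  then have "\<forall>\<^sub>F n in sequentially. \<forall>e\<in>K. sq_dist \<epsilon>' d (Pn n) e = sq_dist \<epsilon>' d (Sn n) e"
    by (intro eventually_ball_finite finK) auto
  \<comment> \<open>Disagreement on \<open>e1\<close> is an open condition and holds for the limit
    pair by \<open>PS\<close>.\<close>
  moreover have "\<forall>\<^sub>F n in sequentially. sq_dist \<epsilon>' d (Pn n) e1 - sq_dist \<epsilon>' d (Sn n) e1 \<noteq> 0"
  proof (rule tendsto_imp_eventually_ne)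
    show "(\<lambda>n. sq_dist \<epsilon>' d (Pn n) e1 - sq_dist \<epsilon>' d (Sn n) e1) \<longlonglongrightarrow> sq_dist \<epsilon>' d P e1 - sq_dist \<epsilon>' d S e1"
      by (intro tendsto_intros tendsto_edge_form[OF e1(1)] Plim Slim)
    show "sq_dist \<epsilon>' d P e1 - sq_dist \<epsilon>' d S e1 \<noteq> 0" using PS[of e1] e1(2) by simp
  qed
  ultimately have "\<forall>\<^sub>F n in sequentially. (\<forall>e\<in>K. sq_dist \<epsilon>' d (Pn n) e = sq_dist \<epsilon>' d (Sn n) e) \<and>
      sq_dist \<epsilon>' d (Pn n) e1 - sq_dist \<epsilon>' d (Sn n) e1 \<noteq> 0"
    by (rule eventually_conj)
  from eventually_happens'[OF sequentially_bot this]
  obtain n where n: "\<forall>e\<in>K. sq_dist \<epsilon>' d (Pn n) e = sq_dist \<epsilon>' d (Sn n) e"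
    "sq_dist \<epsilon>' d (Sn n) e1 \<noteq> sq_dist \<epsilon>' d (Pn n) e1" by auto
  \<comment> \<open>The roles are swapped: the approximants of \<open>S\<close> were chosen generic,
    while \<open>Pn\<close> was solved for.\<close>
  have "flexible_pair \<epsilon>' d V K (Sn n) (Pn n)"
    unfolding flexible_pair_def
    by (intro conjI bexI[of _ e1] Sgen) (use n e1(1) in simp_all)
  then show ?thesis unfolding \<epsilon>'_def by blast
qed

section \<open>From flexible pairs back to \<open>GGR\<close>\<close>

definition signs :: "nat \<Rightarrow> nat \<Rightarrow> real" where
  "signs s i = (if i < s then -1 else 1)"

lemma psq_eq_sq_dist:
  assumes "s \<le> d"
  shows "psq s d (p t - p u) = sq_dist (signs s) d p (t, u)"
proof -
  have d: "{..<d} = {..<s} \<union> {s..<d}" using assms by auto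
  have "sq_dist (signs s) d p (t, u) = (\<Sum>i\<in>{..<s} \<union> {s..<d}. signs s i * (p t i - p u i)\<^sup>2)"
    unfolding edge_form_def d by (simp add: power2_eq_square)
  also have "\<dots> = (\<Sum>i<s. signs s i * (p t i - p u i)\<^sup>2) + (\<Sum>i\<in>{s..<d}. signs s i * (p t i - p u i)\<^sup>2)"
    by (rule sum.union_disjoint) auto
  finally show ?thesis by (simp add: psq_def signs_def sum_negf)
qed

lemma GGR_iff_no_flexible_pair:
  assumes "s \<le> d"
  shows "GGR s d V E \<longleftrightarrow> \<not> (\<exists>\<rho> \<sigma>. flexible_pair (signs s) d V {(t, u). {t, u} \<in> E} \<rho> \<sigma>)"
  unfolding GGR_def globally_rigid_def equivalent_fw_def congruent_fw_def flexible_pair_def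
    psq_eq_sq_dist[OF assms] Ball_def Bex_def split_paired_All split_paired_Ex mem_Sigma_iff
    mem_Collect_eq prod.case
  by blast

text \<open>The two sign vectors differ only at coordinate \<open>s\<close>, and flipping that sign
  twice restores it, so one flip lemma gives both directions.\<close>

lemma GGR_Suc:
  assumes "is_graph V E" "Suc s \<le> d"
  shows "GGR s d V E \<longleftrightarrow> GGR (Suc s) d V E"
proof -
  have V: "finite V" and K: "{(t, u). {t, u} \<in> E} \<subseteq> V \<times> V"
    using assms(1) unfolding is_graph_def by (auto simp: doubleton_eq_iff)
  have "\<forall>i. signs s i \<in> {1, -1}" for s by (simp add: signs_def)
  note flip = flexible_pair_flip_sign[OF V K this, of s d]
  have sg: "(signs s)(s := - signs s s) = signs (Suc s)"
    "(signs (Suc s))(s := - signs (Suc s) s) = signs s"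
    by (auto simp: signs_def fun_eq_iff)
  have "(\<exists>\<rho> \<sigma>. flexible_pair (signs s) d V {(t, u). {t, u} \<in> E} \<rho> \<sigma>) \<longleftrightarrow>
      (\<exists>\<rho> \<sigma>. flexible_pair (signs (Suc s)) d V {(t, u). {t, u} \<in> E} \<rho> \<sigma>)"
    using assms(2) flip[of s, unfolded sg] flip[of "Suc s", unfolded sg] by (meson Suc_le_eq)
  then show ?thesis
    using assms(2) by (simp add: GGR_iff_no_flexible_pair)
qed

theorem mainTheorem3:
  fixes V :: "'v set" and E :: "'v set set" and s d :: nat
  assumes "is_graph V E" and "s \<le> d"
  shows "GGR 0 d V E \<longleftrightarrow> GGR s d V E"
  using assms(2)
proof (induction s)
  case (Suc s)
  then show ?case using GGR_Suc[OF assms(1)] by simp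
qed simp

end
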